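(* Let $p$ be a prime, $n$ a positive integer, $B$ a bottom segment of $n$ (in base $p$), and $k$ an integer such that $0<k\le B$. Suppose that $p-1\mid B-k$ and $p\nmid\binom{n+(B-k)/(p-1)}{n}$. Let $M$ be the maximum pole of $B_{n-k}^{(-k)}(x)$. Then: (a) $M=\sigma_p(B-k)/(p-1)$, and the first occurrence of this pole in the higher order Bernoulli polynomial $B_{n-k}^{(-k)}(x)$ is in degree $n-k-(B-k)=n-B$. (b) Furthermore, if $p-1\mid n-k$, then $S(n,k)$ is an almost minimum zero case (AMZC) and $$\nu_p(S(n,k))=\frac{\sigma_p(k)-\sigma_p(B)}{p-1}.$$
   Context: $S(n,k)$ is the Stirling number of the second kind; $\sigma_p(m)$ is the sum of the base $p$ digits of $m\ge 0$; $\nu_p$ is the $p$-adic valuation. If $n=\sum_i n_ip^i$ is the base $p$ expansion, a bottom segment of $n$ is a number of the form $\sum_{i<j}n_ip^i+m p^j$ with $j\ge 0$ and $0\le m\le n_j$. Higher order Bernoulli polynomials $B_m^{(l)}(x)$ ($m\ge 0$, $l\in\mathbb Z$) are defined by $\left(\frac{t}{e^t-1}\right)^l e^{tx}=\sum_{m\ge 0}B_m^{(l)}(x)\frac{t^m}{m!}$; $B_m^{(l)}(x)$ is monic of degree $m$ with rational coefficients, and $B_m^{(l)}=B_m^{(l)}(0)$. A rational number $a$ has a pole of order $M$ if $\nu_p(a)=-M$. The maximum pole of a nonzero rational polynomial is the highest order $M$ of a pole of its coefficients, i.e. $-M$ is the minimum of the $p$-adic valuations of its coefficients. Coefficients are read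 from the highest degree down, so the first occurrence of a pole of order $M$ is in the largest degree whose coefficient has $p$-adic valuation $-M$. For $n\ge k\ge 1$ and $M$ the maximum pole of $B_{n-k}^{(-k)}(x)$, $S(n,k)$ is an almost minimum zero case (AMZC) if $\nu_p(S(n,k))=\nu_p\left(\binom nk\right)-M$ (equivalently $\nu_p(B_{n-k}^{(-k)})=-M$, since $S(n,k)=\binom nk B_{n-k}^{(-k)}$). *)

theory Defs
  imports
    "HOL-Computational_Algebra.Computational_Algebra"
    "HOL-Combinatorics.Stirling"
begin

text \<open>Base \<open>p\<close> digits, for \<open>p \<ge> 2\<close>.\<close>

definition base_digit :: "nat \<Rightarrow> nat \<Rightarrow> nat \<Rightarrow> nat" where
  "base_digit p n i = n div p ^ i mod p"

text \<open>All digits of \<open>m\<close> in positions \<open>i > m\<close> vanish, since \<open>m < p ^ i\<close> there.\<close>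

definition digit_sum :: "nat \<Rightarrow> nat \<Rightarrow> nat" where
  "digit_sum p m = (\<Sum>i\<le>m. base_digit p m i)"

definition bottom_segment :: "nat \<Rightarrow> nat \<Rightarrow> nat \<Rightarrow> bool" where
  "bottom_segment p n B \<longleftrightarrow>
     (\<exists>j m. m \<le> base_digit p n j \<and> B = (\<Sum>i<j. base_digit p n i * p ^ i) + m * p ^ j)"

text \<open>
  The \<open>p\<close>-adic valuation of a nonzero rational number. At 0 it has the junk value 0
  (instead of infinity), so all uses are guarded by \<open>a \<noteq> 0\<close>.
\<close>

definition padic_val :: "nat \<Rightarrow> rat \<Rightarrow> int" where
  "padic_val p a =
     int (multiplicity (int p) (fst (quotient_of a))) -
     int (multiplicity (int p) (snd (quotient_of a)))"

definition has_pole :: "nat \<Rightarrow> rat \<Rightarrow> int \<Rightarrow> bool" where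
  "has_pole p a M \<longleftrightarrow> a \<noteq> 0 \<and> padic_val p a = - M"

text \<open>Meaningful for \<open>f \<noteq> 0\<close>, when the set below is finite and nonempty.\<close>

definition max_pole :: "nat \<Rightarrow> rat poly \<Rightarrow> int" where
  "max_pole p f = Max {M. \<exists>i. has_pole p (coeff f i) M}"

text \<open>Coefficients are read from the highest degree down.\<close>

definition first_pole_occurrence :: "nat \<Rightarrow> rat poly \<Rightarrow> int \<Rightarrow> nat \<Rightarrow> bool" where
  "first_pole_occurrence p f M d \<longleftrightarrow>
     has_pole p (coeff f d) M \<and> (\<forall>i>d. \<not> has_pole p (coeff f i) M)"

text \<open>
  The generating function \<open>(t / (e\<^sup>t - 1))\<^sup>l e\<^sup>t\<^sup>x\<close> is a power series in \<open>t\<close> over the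
  polynomials in \<open>x\<close>. The first factor does not involve \<open>x\<close>; it is formed over the field of
  rationals, where \<open>t / (e\<^sup>t - 1)\<close> is a series with constant term 1 and \<open>l\<close> may be negative,
  and then embedded coefficientwise.
\<close>

definition bernoulli_gf :: "int \<Rightarrow> rat poly fps" where
  "bernoulli_gf l =
     Abs_fps (\<lambda>i. [: fps_nth ((fps_X / (fps_exp 1 - 1)) powi l) i :]) *
     Abs_fps (\<lambda>i. monom (1 / fact i) i)"

definition bernoulli_poly :: "nat \<Rightarrow> int \<Rightarrow> rat poly" where
  "bernoulli_poly m l = smult (fact m) (fps_nth (bernoulli_gf l) m)"

text \<open>To be used for \<open>1 \<le> k \<le> n\<close>, so that \<open>Stirling n k\<close> and \<open>n choose k\<close> are nonzero.\<close>

definition AMZC :: "nat \<Rightarrow> nat \<Rightarrow> nat \<Rightarrow> bool" where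
  "AMZC p n k \<longleftrightarrow>
     int (multiplicity p (Stirling n k)) =
     int (multiplicity p (n choose k)) - max_pole p (bernoulli_poly (n - k) (- int k))"

end

theory Submission
  imports Defs
begin

text \<open>
  Put \<open>F(x) = \<Delta>\<^sup>k x\<^sup>n / k!\<close>, which is \<open>n choose k\<close> times the Bernoulli polynomial. In the basis
  \<open>(x - 1) \<dots> (x - l)\<close> it has the integer coefficients
  \<open>y\<^sub>l = (k + l choose l) S(n + 1, k + l + 1) = n! / (k! l!) [X\<^bsup>n-k-l\<^esup>] (X / log (1 + X))\<^bsup>n+1\<^esup>\<close>, and the change
  of basis is unitriangular over the integers, so it suffices to find the valuations of the \<open>y\<^sub>l\<close>.
  Split \<open>log (1 + X) / X\<close> into its \<open>p\<close>-integral part and the part \<open>\<plusminus> (X\<^bsup>p-1\<^esup> / p) A(X\<^sup>p)\<close> with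
  denominators divisible by \<open>p\<close>, and expand the negative power binomially. The factorial
  \<open>(n - k - (p - 1) s)! / l!\<close> absorbs the denominators of \<open>A\<^sup>s\<close>, so the \<open>s\<close>-th term is at least as
  divisible as \<open>(n + s)! / (k! (n - k - (p - 1) s)! s! p\<^sup>s)\<close>. By Legendre's formula this reduces
  everything to inequalities between digit sums, with equality at \<open>s = (B - k) / (p - 1)\<close>, which
  gives the first occurrence of the pole. For \<open>S(n, k) = F(0) = \<Sum> (-1)\<^sup>l l! y\<^sub>l\<close> only the term with
  \<open>l = 0\<close>, \<open>s = (n - k) / (p - 1)\<close> survives; the delicate case is \<open>p = 2\<close>.
\<close>

section \<open>Digit sums\<close>

lemma digit_sum_eq_sum_lessThan:
  assumes "2 \<le> p" "n < K"
  shows "digit_sum p n = (\<Sum>i<K. base_digit p n i)"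
proof -
  have "base_digit p n i = 0" if "n < i" for i
  proof -
    have "n < 2 ^ n" by (rule less_exp)
    also have "\<dots> \<le> p ^ n" using assms by (intro power_mono) auto
    also have "\<dots> \<le> p ^ i" using that assms by (intro power_increasing) auto
    finally show ?thesis by (simp add: base_digit_def)
  qed
  thus ?thesis
    unfolding digit_sum_def using assms(2) by (intro sum.mono_neutral_left) auto
qed

lemma digit_sum_rec:
  assumes "2 \<le> p"
  shows "digit_sum p n = n mod p + digit_sum p (n div p)"
proof -
  have "n div p < Suc n"
    using div_le_dividend[of n p] by linarith
  have "digit_sum p n = (\<Sum>i<Suc (Suc n). base_digit p n i)"
    by (rule digit_sum_eq_sum_lessThan) (use assms in auto)
  also have "\<dots> = base_digit p n 0 + (\<Sum>i<Suc n. base_digit p n (Suc i))"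
    by (rule sum.lessThan_Suc_shift)
  also have "(\<Sum>i<Suc n. base_digit p n (Suc i)) = (\<Sum>i<Suc n. base_digit p (n div p) i)"
    by (simp add: base_digit_def div_mult2_eq)
  also have "\<dots> = digit_sum p (n div p)"
    by (rule digit_sum_eq_sum_lessThan[symmetric]) (use assms \<open>n div p < Suc n\<close> in auto)
  finally show ?thesis by (simp add: base_digit_def)
qed

lemma digit_sum_0 [simp]: "digit_sum p 0 = 0"
  by (simp add: digit_sum_def base_digit_def)

lemma digit_sum_less_base:
  assumes "2 \<le> p" "x < p"
  shows "digit_sum p x = x"
  using digit_sum_rec[OF assms(1), of x] assms by simp

lemma digit_sum_add_mult:
  assumes "2 \<le> p" "x < p"
  shows "digit_sum p (x + p * y) = x + digit_sum p y"
  using digit_sum_rec[OF assms(1), of "x + p * y"] assms by simp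

lemma digit_sum_mult_base:
  assumes "2 \<le> p"
  shows "digit_sum p (p * y) = digit_sum p y"
  using digit_sum_add_mult[OF assms, of 0] assms by simp

text \<open>The digits of \<open>x\<close> stay below position \<open>j\<close> and those of
  \<open>y\<close> move to position \<open>j\<close> and above, so the two blocks do not meet. Later
  digit estimates split numbers this way.\<close>

lemma digit_sum_add_power_mult:
  assumes "2 \<le> p" "x < p ^ j"
  shows "digit_sum p (x + p ^ j * y) = digit_sum p x + digit_sum p y"
  using assms(2)
proof (induction j arbitrary: x)
  case (Suc j)
  have "x div p < p ^ j"
    using Suc.prems assms(1) by (simp add: less_mult_imp_div_less mult.commute)
  note IH = Suc.IH[OF this]
  have "x + p ^ Suc j * y = x mod p + p * (x div p + p ^ j * y)"
    by (simp add: algebra_simps)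
  also have "digit_sum p \<dots> = x mod p + digit_sum p (x div p + p ^ j * y)"
    using assms by (intro digit_sum_add_mult) auto
  finally show ?case
    using IH digit_sum_rec[OF assms(1), of x] by simp
qed simp

lemma digit_sum_power_mult:
  assumes "2 \<le> p"
  shows "digit_sum p (p ^ j * y) = digit_sum p y"
  using digit_sum_add_power_mult[OF assms, of 0 j y] assms by simp

lemma digit_sum_pos:
  assumes "2 \<le> p" "0 < x"
  shows "0 < digit_sum p x"
  using assms(2)
proof (induction x rule: less_induct)
  case (less x)
  show ?case
  proof (cases "x < p")
    case True
    thus ?thesis using less.prems digit_sum_less_base[OF assms(1)] by simp
  next
    case False
    hence "0 < x div p" "x div p < x"
      using assms(1) less.prems by (auto simp: div_greater_zero_iff)
    thus ?thesis using less.IH digit_sum_rec[OF assms(1), of x] by force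
  qed
qed

text \<open>The trailing digits \<open>p - 1\<close> of \<open>n\<close> become zeros and the next
  digit grows by one; their number is the multiplicity of \<open>p\<close> in \<open>Suc n\<close>.
  The induction strips one such digit at a time.\<close>

lemma digit_sum_Suc:
  assumes "prime p"
  shows "digit_sum p (Suc n) + (p - 1) * multiplicity p (Suc n) = Suc (digit_sum p n)"
proof (induction n rule: less_induct)
  case (less n)
  have p2: "2 \<le> p" using assms by (rule prime_ge_2_nat)
  show ?case
  proof (cases "p dvd Suc n")
    case True
    then obtain t where t: "Suc n = p * t" by auto
    then obtain u where u: "t = Suc u" by (cases t) auto
    have n: "n = (p - 1) + p * u"
      using t u p2 by simp
    have "u < p * Suc u" using p2 by (metis less_le_trans lessI mult_le_mono1 mult_1 one_le_numeral order_trans)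
    hence "u < n \<or> n = u" using t u by auto
    moreover have "n \<noteq> u" using n p2 by (cases u) (auto simp: mult_eq_if)
    ultimately have IH: "digit_sum p (Suc u) + (p - 1) * multiplicity p (Suc u) = Suc (digit_sum p u)"
      using less.IH by blast
    have "multiplicity p (p * Suc u) = Suc (multiplicity p (Suc u))"
      by (rule multiplicity_times_same) (use assms p2 in auto)
    moreover have "digit_sum p n = p - 1 + digit_sum p u"
      unfolding n using p2 by (intro digit_sum_add_mult) auto
    moreover have "digit_sum p (p * Suc u) = digit_sum p (Suc u)"
      by (rule digit_sum_mult_base[OF p2])
    ultimately show ?thesis
      using IH unfolding t u by simp
  next
    case False
    hence "Suc n mod p = Suc (n mod p)" "Suc n div p = n div p"
      by (auto simp: mod_Suc div_Suc dvd_eq_mod_eq_0 split: if_splits)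
    moreover have "multiplicity p (Suc n) = 0"
      using False by (rule not_dvd_imp_multiplicity_0)
    ultimately show ?thesis
      using digit_sum_rec[OF p2, of n] digit_sum_rec[OF p2, of "Suc n"] by simp
  qed
qed

text \<open>Legendre's formula, obtained by telescoping \<open>digit_sum_Suc\<close>.\<close>

lemma legendre_digit_sum:
  assumes "prime p"
  shows "(p - 1) * multiplicity p (fact n :: nat) + digit_sum p n = n"
proof (induction n)
  case (Suc n)
  have "multiplicity p (fact (Suc n) :: nat) = multiplicity p (Suc n) + multiplicity p (fact n :: nat)"
    unfolding fact_Suc of_nat_id
    by (rule prime_elem_multiplicity_mult_distrib) (use assms in auto)
  thus ?case
    using Suc digit_sum_Suc[OF assms, of n] by (simp add: algebra_simps)
qed simp

text \<open>Kummer's theorem: each carry in \<open>x + y\<close> lowers the digit sum by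
  \<open>p - 1\<close>, and the multiplicity counts the carries.\<close>

lemma digit_sum_binomial:
  assumes "prime p"
  shows "(p - 1) * multiplicity p ((x + y) choose x) + digit_sum p (x + y) =
         digit_sum p x + digit_sum p y"
proof -
  have "(fact (x + y) :: nat) = fact x * fact y * ((x + y) choose x)"
    using binomial_fact_lemma[of x "x + y"] by simp
  hence "multiplicity p (fact (x + y) :: nat) =
        multiplicity p (fact x :: nat) + multiplicity p (fact y :: nat) + multiplicity p ((x + y) choose x)"
    using assms by (simp add: prime_elem_multiplicity_mult_distrib)
  thus ?thesis
    using legendre_digit_sum[OF assms, of "x + y"] legendre_digit_sum[OF assms, of x]
      legendre_digit_sum[OF assms, of y]
    by (simp add: algebra_simps)
qed

lemma digit_sum_add_le:
  assumes "prime p"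
  shows "digit_sum p (x + y) \<le> digit_sum p x + digit_sum p y"
  using digit_sum_binomial[OF assms, of x y] by linarith

lemma digit_sum_le:
  assumes "prime p"
  shows "digit_sum p x \<le> x"
  using legendre_digit_sum[OF assms, of x] by linarith

text \<open>Powers of \<open>p\<close> are 1 modulo \<open>p - 1\<close>; here the congruence is
  read off from Legendre's formula.\<close>

lemma digit_sum_cong:
  assumes "prime p"
  shows "int (p - 1) dvd int x - int (digit_sum p x)"
proof -
  have "int x - int (digit_sum p x) = int (p - 1) * int (multiplicity p (fact x :: nat))"
    using legendre_digit_sum[OF assms, of x] by (metis add_diff_cancel_right' of_nat_add of_nat_mult)
  thus ?thesis by simp
qed

text \<open>Numbers of at most \<open>j\<close> digits whose sum reaches \<open>p ^ j\<close> must
  carry. Either the lowest digits carry, which costs \<open>p - 1\<close>, or the carry arises in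
  the remaining digits and the induction applies.\<close>

lemma digit_sum_add_carry:
  assumes "prime p" "x < p ^ j" "y < p ^ j" "p ^ j \<le> x + y"
  shows "digit_sum p (x + y) < digit_sum p x + digit_sum p y"
  using assms(2-)
proof (induction j arbitrary: x y)
  case (Suc j)
  have p2: "2 \<le> p" using assms(1) by (rule prime_ge_2_nat)
  define a b c d where "a = x mod p" "b = x div p" "c = y mod p" "d = y div p"
  note defs = this
  have x: "x = a + p * b" and y: "y = c + p * d" and ac: "a < p" "c < p"
    using p2 by (auto simp: defs)
  have bd: "b < p ^ j" "d < p ^ j"
    using Suc.prems p2 by (auto simp: defs less_mult_imp_div_less mult.commute)
  have sx: "digit_sum p x = a + digit_sum p b" and sy: "digit_sum p y = c + digit_sum p d"
    unfolding x y using ac by (auto intro: digit_sum_add_mult[OF p2])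
  show ?case
  proof (cases "a + c < p")
    case True
    have xy: "x + y = (a + c) + p * (b + d)" unfolding x y by (simp add: algebra_simps)
    have "p * p ^ j < p * (b + d + 1)"
      using Suc.prems(3) True unfolding xy by simp
    hence "p ^ j < b + d + 1" by (simp only: mult_less_cancel1)
    hence "p ^ j \<le> b + d" by simp
    hence "digit_sum p (b + d) < digit_sum p b + digit_sum p d"
      using Suc.IH bd by blast
    thus ?thesis unfolding xy sx sy using digit_sum_add_mult[OF p2 True, of "b + d"] by simp
  next
    case False
    have xy: "x + y = (a + c - p) + p * (b + d + 1)"
      unfolding x y using False by (simp add: algebra_simps)
    have "digit_sum p (x + y) = (a + c - p) + digit_sum p (b + d + 1)"
      unfolding xy using ac by (intro digit_sum_add_mult[OF p2]) auto
    also have "digit_sum p (b + d + 1) \<le> digit_sum p b + digit_sum p d + 1"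
      using digit_sum_add_le[OF assms(1), of "b + d" 1] digit_sum_add_le[OF assms(1), of b d]
        digit_sum_less_base[OF p2, of 1] p2 by simp
    finally show ?thesis
      using False p2 unfolding sx sy by linarith
  qed
qed (use assms in simp)

lemma digit_sum_less_self:
  assumes "prime p" "p \<le> x"
  shows "digit_sum p x < x"
proof -
  have "0 < multiplicity p (fact x :: nat)"
    using assms by (subst prime_multiplicity_gt_zero_iff) (auto simp: prime_dvd_fact_iff)
  moreover have "0 < p - 1" using prime_gt_1_nat[OF assms(1)] by simp
  ultimately have "0 < (p - 1) * multiplicity p (fact x :: nat)" by simp
  thus ?thesis using legendre_digit_sum[OF assms(1), of x] by linarith
qed

section \<open>Digits of a bottom segment\<close>

text \<open>
  Here \<open>m\<close> is the nonzero top digit of the bottom segment \<open>B\<close>, in position \<open>j\<close>; the hypothesis on the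
  binomial coefficient says that \<open>n\<close> and \<open>r = (B - k) / (p - 1)\<close> add without carries.
\<close>

locale bottom_digits =
  fixes p j m q B0 r k n B :: nat
  assumes p: "prime p"
    and B0_less: "B0 < p ^ j"
    and m_pos: "0 < m"
    and mq: "m + q mod p < p"
    and r_less: "r < p ^ j"
    and B_eq: "B = B0 + p ^ j * m"
    and n_eq: "n = B + p ^ j * q"
    and B_k: "B = k + (p - 1) * r"
    and B0_r_less: "B0 + r < p ^ j"
    and B0_r: "digit_sum p (B0 + r) = digit_sum p B0 + digit_sum p r"
begin

lemma p2: "2 \<le> p"
  using p by (rule prime_ge_2_nat)

lemma m_less: "m < p"
  using mq by simp

lemma digit_sum_m: "digit_sum p m = m"
  using digit_sum_less_base[OF p2 m_less] .

lemma digit_sum_B: "digit_sum p B = digit_sum p B0 + m"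
  unfolding B_eq using digit_sum_add_power_mult[OF p2 B0_less] digit_sum_m by simp

lemma B_less: "B < p ^ j * Suc m"
  unfolding B_eq using B0_less by simp

text \<open>By \<open>mq\<close>, adding at most \<open>m\<close> to the last digit of
  \<open>q\<close> produces no carry.\<close>

lemma digit_sum_add_q:
  assumes "t \<le> m"
  shows "digit_sum p (t + q) = t + digit_sum p q"
proof -
  have "t + q = (t + q mod p) + p * (q div p)" by simp
  also have "digit_sum p \<dots> = t + q mod p + digit_sum p (q div p)"
    using assms mq by (intro digit_sum_add_mult[OF p2]) auto
  finally show ?thesis using digit_sum_rec[OF p2, of q] by simp
qed

lemma digit_sum_n: "digit_sum p n = digit_sum p B + digit_sum p q"
proof -
  have "n = B0 + p ^ j * (m + q)" by (simp add: n_eq B_eq algebra_simps)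
  thus ?thesis
    using digit_sum_add_power_mult[OF p2 B0_less] digit_sum_add_q[of m] digit_sum_B by simp
qed

lemma digit_sum_n_minus_B: "digit_sum p (n - B) = digit_sum p q"
  using digit_sum_power_mult[OF p2] by (simp add: n_eq)

text \<open>Since \<open>B - k\<close> is below \<open>p ^ j * Suc m\<close>, its part from position
  \<open>j\<close> on is at most \<open>m\<close>, and adding \<open>q\<close> there causes no
  carry.\<close>

lemma digit_sum_n_minus_k: "digit_sum p (n - k) = digit_sum p (B - k) + digit_sum p q"
proof -
  define x where "x = (p - 1) * r"
  have Bk: "B - k = x" using B_k by (simp add: x_def)
  have x: "x = x mod p ^ j + p ^ j * (x div p ^ j)" by simp
  have "x < p ^ j * Suc m" using Bk B_less by linarith
  hence t: "x div p ^ j \<le> m"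
    using p2 by (metis less_Suc_eq_le less_mult_imp_div_less mult.commute)
  have "n - k = x + p ^ j * q" using B_k n_eq by (simp add: x_def)
  also have "\<dots> = x mod p ^ j + p ^ j * (x div p ^ j + q)"
    by (subst (1) x) (simp only: algebra_simps)
  finally have "digit_sum p (n - k) = digit_sum p (x mod p ^ j) + (x div p ^ j + digit_sum p q)"
    using digit_sum_add_power_mult[OF p2, of "x mod p ^ j" j "x div p ^ j + q"] p2
      digit_sum_add_q[OF t] by simp
  moreover have "digit_sum p x = digit_sum p (x mod p ^ j) + x div p ^ j"
    using digit_sum_add_power_mult[OF p2, of "x mod p ^ j" j "x div p ^ j"] p2 t m_less
      digit_sum_less_base[OF p2, of "x div p ^ j"] by simp
  ultimately show ?thesis using Bk by simp
qed

text \<open>The excess vanishes at \<open>s = r\<close>, where \<open>c = n - B\<close>: below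
  position \<open>j\<close> this is \<open>B0_r\<close>, above it
  \<open>digit_sum_add_q\<close>.\<close>

lemma slack_r: "digit_sum p (n + r) = digit_sum p B + digit_sum p r + digit_sum p (n - B)"
proof -
  have nr: "n + r = (B0 + r) + p ^ j * (m + q)" by (simp add: n_eq B_eq algebra_simps)
  show ?thesis
    unfolding nr using digit_sum_add_power_mult[OF p2 B0_r_less] B0_r digit_sum_add_q[of m] digit_sum_B
      digit_sum_n_minus_B by simp
qed

text \<open>The excess also vanishes at the largest index \<open>s = S\<close>, where
  \<open>c = 0\<close>.\<close>

lemma slack_max:
  assumes "n - k = (p - 1) * S" and "k \<le> n"
  shows "digit_sum p (n + S) = digit_sum p B + digit_sum p S"
proof -
  have rS: "r \<le> S"
  proof -
    have "(p - 1) * r \<le> (p - 1) * S" using B_k n_eq assms by linarith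
    thus ?thesis using p2 by simp
  qed
  have "p ^ j * q = (p - 1) * (S - r)"
    using assms B_k n_eq by (simp add: diff_mult_distrib2)
  \<comment> \<open>Coprimality moves \<open>p ^ j\<close> onto \<open>S - r\<close>: thus
    \<open>S\<close> and \<open>r\<close> agree in their lowest \<open>j\<close> digits.\<close>
  moreover have "coprime (p ^ j) (p - 1)"
    using p2 by (metis coprime_diff_one_right_nat coprime_power_left_iff not_numeral_le_zero zero_less_iff_neq_zero)
  ultimately have "p ^ j dvd S - r" by (metis coprime_dvd_mult_right_iff dvd_triv_left)
  then obtain q' where q': "S - r = p ^ j * q'" by auto
  have "p ^ j * q = p ^ j * ((p - 1) * q')"
    using \<open>p ^ j * q = (p - 1) * (S - r)\<close> q' by (simp add: algebra_simps)
  hence q: "q = (p - 1) * q'" using p2 by simp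
  \<comment> \<open>Turns \<open>m + q + q'\<close> into \<open>m + p * q'\<close>, where the digit
    \<open>m\<close> and the shifted digits of \<open>q'\<close> do not meet.\<close>
  have pq: "p * q' = q + q'" unfolding q using p2 by (cases p) auto
  have S: "S = r + p ^ j * q'" using q' rS by simp
  have nS: "n + S = (B0 + r) + p ^ j * (m + p * q')"
    unfolding S n_eq B_eq pq by (simp add: algebra_simps)
  show ?thesis
    unfolding nS unfolding S using digit_sum_add_power_mult[OF p2 B0_r_less] digit_sum_add_power_mult[OF p2 r_less]
      B0_r digit_sum_B digit_sum_add_mult[OF p2 m_less] by simp
qed

lemma digit_sum_n_plus:
  "digit_sum p (n + s) \<le>
     digit_sum p B0 + digit_sum p (s mod p ^ j) + digit_sum p (m + q + s div p ^ j)"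
proof -
  have "n + s = (B0 + s mod p ^ j) + p ^ j * (m + q + s div p ^ j)"
    by (simp add: n_eq B_eq algebra_simps)
  hence "digit_sum p (n + s) \<le> digit_sum p (B0 + s mod p ^ j) + digit_sum p (m + q + s div p ^ j)"
    using digit_sum_add_le[OF p] digit_sum_power_mult[OF p2] by metis
  thus ?thesis using digit_sum_add_le[OF p, of B0 "s mod p ^ j"] by linarith
qed

text \<open>
  In the next lemmas \<open>\<sigma>(B) + \<sigma>(s) + \<sigma>(c) - \<sigma>(n + s)\<close> is \<open>p - 1\<close> times the excess of the valuation of
  the \<open>s\<close>-th term of the expansion over the minimal one.
\<close>

context
  fixes s c
  assumes c: "n = k + (p - 1) * s + c"
begin

private abbreviation "P \<equiv> p ^ j"
private abbreviation "s0 \<equiv> s mod P"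
private abbreviation "s1 \<equiv> s div P"
private abbreviation "c0 \<equiv> c mod P"
private abbreviation "u \<equiv> c div P"

private lemma P_pos: "0 < P"
  using p2 by simp

private lemma split_s: "digit_sum p s = digit_sum p s0 + digit_sum p s1"
  using digit_sum_add_power_mult[OF p2, of s0 j s1] P_pos by simp

private lemma split_c: "digit_sum p c = digit_sum p c0 + digit_sum p u"
  using digit_sum_add_power_mult[OF p2, of c0 j u] P_pos by simp

text \<open>Both sides are \<open>n - k\<close>: on the left through \<open>s\<close> and
  \<open>c\<close>, each split at position \<open>j\<close>, on the right through \<open>q\<close>
  and \<open>r\<close>.\<close>

private lemma balance: "(c0 + P * (u + (p - 1) * s1)) + (p - 1) * s0 = P * q + (p - 1) * r"
proof -
  have "(p - 1) * s + c = P * q + (p - 1) * r"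
    using c n_eq B_k by simp
  moreover have "(p - 1) * s = (p - 1) * s0 + P * ((p - 1) * s1)"
    by (metis (no_types, opaque_lifting) distrib_left mod_mult_div_eq mult.left_commute)
  moreover have "c = c0 + P * u" by simp
  ultimately show ?thesis by (simp only: distrib_left)
qed

text \<open>Let \<open>z\<close> be the part of \<open>(p - 1) * (r - s0)\<close> from position
  \<open>j\<close> on. Then \<open>u + (p - 1) * s1 = z + q\<close>, hence
  \<open>m + q + s1 = (m - z) + (u + p * s1)\<close>, and the excess is at least
  \<open>z + digit_sum p c0\<close>. This vanishes only for \<open>s0 = r\<close>.\<close>

lemma slack_low:
  assumes "s0 \<le> r"
  shows "digit_sum p (n + s) \<le> digit_sum p B + digit_sum p s + digit_sum p c"
    and "s0 < r \<Longrightarrow> digit_sum p (n + s) < digit_sum p B + digit_sum p s + digit_sum p c"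
proof -
  define x where "x = (p - 1) * (r - s0)"
  define z where "z = x div P"
  have "(p - 1) * r = x + (p - 1) * s0"
    using assms by (simp add: x_def flip: distrib_left)
  hence eq: "c0 + P * (u + (p - 1) * s1) = x + P * q"
    using balance by simp
  have c0: "c0 = x mod P"
    using arg_cong[OF eq, of "\<lambda>t. t mod P"] P_pos by simp
  have "(c0 + P * (u + (p - 1) * s1)) div P = u + (p - 1) * s1" "(x + P * q) div P = z + q"
    using P_pos by (simp_all add: z_def)
  hence uz: "u + (p - 1) * s1 = z + q" using eq by simp
  have "x \<le> (p - 1) * r" by (simp add: x_def)
  hence "x < P * Suc m" using B_less B_k by linarith
  hence zm: "z \<le> m"
    unfolding z_def using less_mult_imp_div_less[of x "Suc m" P] by (simp add: mult.commute)
  have "p * s1 = (p - 1) * s1 + s1" using p2 by (cases p) auto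
  hence mqs: "m + q + s1 = (m - z) + (u + p * s1)"
    using uz zm by simp
  have "digit_sum p (m + q + s1) \<le> digit_sum p (m - z) + (digit_sum p u + digit_sum p s1)"
    unfolding mqs using digit_sum_add_le[OF p, of "m - z" "u + p * s1"] digit_sum_add_le[OF p, of u "p * s1"]
      digit_sum_mult_base[OF p2, of s1] by simp
  also have "digit_sum p (m - z) \<le> m - z" by (rule digit_sum_le[OF p])
  finally have *: "digit_sum p (n + s) + z + digit_sum p c0 \<le>
      digit_sum p B + digit_sum p s + digit_sum p c"
    using digit_sum_n_plus[of s] split_s split_c digit_sum_B zm by linarith
  thus "digit_sum p (n + s) \<le> digit_sum p B + digit_sum p s + digit_sum p c" by simp
  assume "s0 < r"
  hence "0 < x" using p2 by (simp add: x_def)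
  have "0 < z + digit_sum p c0"
  proof (cases "z = 0")
    case True
    hence "c0 = x" using c0 P_pos by (metis z_def div_eq_0_iff mod_less less_not_refl)
    thus ?thesis using \<open>0 < x\<close> digit_sum_pos[OF p2] by simp
  qed simp
  thus "digit_sum p (n + s) < digit_sum p B + digit_sum p s + digit_sum p c"
    using * by linarith
qed

text \<open>Now \<open>c0 + (p - 1) * (s0 - r) = P * z\<close> with \<open>0 < z < p\<close>, and
  \<open>q\<close> exceeds \<open>u + (p - 1) * s1\<close> by \<open>z\<close>. The excess is at
  least \<open>m + digit_sum p c0 - digit_sum p (m + z)\<close>, which is nonnegative as
  \<open>z \<le> digit_sum p c0\<close>, and positive as soon as \<open>m + z\<close> reaches
  \<open>p\<close>.\<close>

lemma slack_high:
  assumes "r < s0"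
  obtains z where "0 < z" "z < p" "z \<le> digit_sum p c0" "int (p - 1) dvd int c0 - int z"
    "digit_sum p (n + s) + m + digit_sum p c0 \<le>
      digit_sum p B + digit_sum p s + digit_sum p c + digit_sum p (m + z)"
proof -
  define x where "x = (p - 1) * (s0 - r)"
  have "(p - 1) * s0 = x + (p - 1) * r"
    using assms by (simp add: x_def flip: distrib_left)
  hence eq: "c0 + P * (u + (p - 1) * s1) + x = P * q"
    using balance by simp
  have "0 < x" using assms p2 by (simp add: x_def)
  hence "P * (u + (p - 1) * s1) < P * q" using eq by linarith
  hence "u + (p - 1) * s1 < q" by simp
  then obtain z where q: "q = (u + (p - 1) * s1) + z" and z0: "0 < z"
    using less_imp_add_positive by blast
  have "P * q = P * (u + (p - 1) * s1) + P * z" unfolding q by (rule distrib_left)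
  hence cz: "c0 + x = P * z" using eq by linarith
  have "s0 < P" "c0 < P" using P_pos by auto
  have xle: "x \<le> (p - 1) * (P - 1)" unfolding x_def using \<open>s0 < P\<close> by (intro mult_le_mono) auto
  hence "P * z \<le> (P - 1) + (p - 1) * (P - 1)" using cz \<open>c0 < P\<close> by linarith
  also have "\<dots> = p * (P - 1)" using p2 by (cases p) auto
  also have "\<dots> < P * p" using P_pos p2 by (simp add: diff_mult_distrib2 mult.commute)
  finally have zp: "z < p" by simp
  \<comment> \<open>With \<open>P\<close> being 1 modulo \<open>p - 1\<close>, the equation
    \<open>cz\<close> reduces to a congruence between \<open>c0\<close> and
    \<open>z\<close>.\<close>
  have "int (p - 1) dvd int P - 1"
  proof -
    have "int P - 1 = (int p - 1) * (\<Sum>i<j. int p ^ i)"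
      using power_diff_1_eq[of "int p" j] by simp
    thus ?thesis using p2 by (simp add: of_nat_diff)
  qed
  moreover have "int c0 - int z = (int P - 1) * int z - int (p - 1) * int (s0 - r)"
  proof -
    have "int c0 + int (p - 1) * int (s0 - r) = int P * int z"
      using arg_cong[OF cz, of int] unfolding x_def by (simp only: of_nat_add of_nat_mult)
    thus ?thesis by (simp only: left_diff_distrib mult_1)
  qed
  ultimately have dv: "int (p - 1) dvd int c0 - int z" by simp
  have "int (p - 1) dvd int z - int (digit_sum p c0)"
    using dvd_diff[OF digit_sum_cong[OF p, of c0] dv] by simp
  \<comment> \<open>Congruence modulo \<open>p - 1\<close> and \<open>z < p\<close> leave one way to
    fail: \<open>digit_sum p c0 = 0\<close> and \<open>z = p - 1\<close>. Then
    \<open>c0 = 0\<close>, and \<open>x = P * (p - 1)\<close> exceeds the bound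
    \<open>xle\<close>.\<close>
  hence le: "z \<le> digit_sum p c0"
  proof (rule contrapos_pp)
    assume "\<not> z \<le> digit_sum p c0"
    hence lt: "digit_sum p c0 < z" by simp
    show "\<not> int (p - 1) dvd int z - int (digit_sum p c0)"
    proof
      assume "int (p - 1) dvd int z - int (digit_sum p c0)"
      hence "int (p - 1) \<le> int z - int (digit_sum p c0)"
        using lt by (intro zdvd_imp_le) auto
      hence "digit_sum p c0 = 0" "z = p - 1" using zp by auto
      hence "c0 = 0" using digit_sum_pos[OF p2, of c0] by auto
      hence "x = P * (p - 1)" using cz \<open>z = p - 1\<close> by simp
      moreover have "(p - 1) * (P - 1) < (p - 1) * P" using P_pos p2 by simp
      ultimately show False using xle by (simp add: mult.commute)
    qed
  qed
  have "p * s1 = (p - 1) * s1 + s1" using p2 by (cases p) auto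
  hence mqs: "m + q + s1 = (m + z) + (u + p * s1)"
    using q by simp
  have "digit_sum p (m + q + s1) \<le> digit_sum p (m + z) + (digit_sum p u + digit_sum p s1)"
    unfolding mqs using digit_sum_add_le[OF p, of "m + z" "u + p * s1"] digit_sum_add_le[OF p, of u "p * s1"]
      digit_sum_mult_base[OF p2, of s1] by simp
  hence "digit_sum p (n + s) + m + digit_sum p c0 \<le>
      digit_sum p B + digit_sum p s + digit_sum p c + digit_sum p (m + z)"
    using digit_sum_n_plus[of s] split_s split_c digit_sum_B by linarith
  with that z0 zp le dv show ?thesis by simp
qed

lemma slack_nonneg: "digit_sum p (n + s) \<le> digit_sum p B + digit_sum p s + digit_sum p c"
proof (cases "s0 \<le> r")
  case False
  then obtain z where "z \<le> digit_sum p c0"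
    "digit_sum p (n + s) + m + digit_sum p c0 \<le>
      digit_sum p B + digit_sum p s + digit_sum p c + digit_sum p (m + z)"
    using slack_high by (metis not_le)
  thus ?thesis using digit_sum_le[OF p, of "m + z"] by linarith
qed (rule slack_low)

lemma slack_pos_less:
  assumes "s < r"
  shows "digit_sum p (n + s) < digit_sum p B + digit_sum p s + digit_sum p c"
  using assms r_less by (intro slack_low) auto

text \<open>For \<open>p = 2\<close> both \<open>m\<close> and \<open>z\<close> are at least 1, so
  \<open>m + z\<close> always carries in the case \<open>r < s0\<close>.\<close>

lemma slack_pos_2:
  assumes "p = 2" "s0 \<noteq> r"
  shows "digit_sum p (n + s) < digit_sum p B + digit_sum p s + digit_sum p c"
proof (cases "s0 < r")
  case False
  then obtain z where z: "0 < z" "z \<le> digit_sum p c0"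
    "digit_sum p (n + s) + m + digit_sum p c0 \<le>
      digit_sum p B + digit_sum p s + digit_sum p c + digit_sum p (m + z)"
    using slack_high assms by (metis not_less_iff_gr_or_eq)
  have "digit_sum p (m + z) < m + z"
    using z(1) m_pos assms(1) by (intro digit_sum_less_self[OF p]) auto
  thus ?thesis using z by linarith
qed (intro slack_low; simp)

text \<open>Here \<open>fact c\<close> is prime to \<open>p\<close>, so the constant term needs
  strictness from the digits alone. If \<open>j > 0\<close>, then \<open>s0 = r\<close> would make
  \<open>P\<close> divide \<open>p - 1\<close>, and \<open>r < s0\<close> forces
  \<open>z = p - 1\<close>, so that \<open>m + z\<close> carries. The case \<open>j = 0\<close> is
  computed directly.\<close>

lemma slack_pos_last:
  assumes "c = p - 1"
  shows "digit_sum p (n + s) < digit_sum p B + digit_sum p s + digit_sum p c"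
proof (cases "j = 0")
  case True
  hence "q = (p - 1) + (p - 1) * s" "B0 = 0" "r = 0"
    using balance B0_less r_less assms by auto
  hence "n + s = (m - 1) + p * (s + 1)"
    using m_pos p2 unfolding n_eq B_eq True by (cases p; cases m) auto
  hence "digit_sum p (n + s) = (m - 1) + digit_sum p (s + 1)"
    using digit_sum_add_mult[OF p2, of "m - 1" "s + 1"] m_less by simp
  also have "digit_sum p (s + 1) \<le> digit_sum p s + 1"
    using digit_sum_add_le[OF p, of s 1] digit_sum_less_base[OF p2, of 1] p2 by simp
  finally have "digit_sum p (n + s) \<le> m - 1 + (digit_sum p s + 1)" by simp
  moreover have "digit_sum p c = p - 1" using digit_sum_less_base[OF p2, of c] p2 assms by simp
  ultimately show ?thesis using m_pos p2 digit_sum_B by linarith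
next
  case False
  have "p \<le> P" using False p2 by (cases j) auto
  hence cP: "c < P" using assms p2 by linarith
  hence c0: "c0 = p - 1" using assms by simp
  consider "s0 < r" | "s0 = r" | "r < s0" by linarith
  thus ?thesis
  proof cases
    case 2
    hence "c0 + P * (u + (p - 1) * s1) = P * q" using balance by simp
    hence "P dvd c0" by (metis dvd_add_left_iff dvd_triv_left)
    hence "c0 = 0" using cP by (auto dest: dvd_imp_le)
    thus ?thesis using c0 p2 by simp
  next
    case 3
    then obtain z where z: "0 < z" "z < p" "z \<le> digit_sum p c0"
      "int (p - 1) dvd int c0 - int z"
      "digit_sum p (n + s) + m + digit_sum p c0 \<le>
      digit_sum p B + digit_sum p s + digit_sum p c + digit_sum p (m + z)"
      using slack_high by metis
    have "int (p - 1) dvd int (p - 1) - int z" using z(4) c0 by simp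
    hence "p - 1 dvd z" by (simp add: dvd_diff_right_iff)
    hence "z = p - 1" using z(1,2) by (auto dest: dvd_imp_le)
    hence "digit_sum p (m + z) < m + z"
      using m_pos p2 by (intro digit_sum_less_self[OF p]) auto
    thus ?thesis using z by linarith
  qed (intro slack_low; simp)
qed

end

end

section \<open>The p-adic valuation of rationals\<close>

text \<open>Frees the valuation from the reduced fraction used in its definition, by
  cross-multiplication.\<close>

lemma padic_val_divide_int:
  assumes "prime p" "a \<noteq> 0" "b \<noteq> 0"
  shows "padic_val p (of_int a / of_int b) =
    int (multiplicity (int p) a) - int (multiplicity (int p) b)"
proof -
  define x :: rat where "x = of_int a / of_int b"
  obtain c d where cd: "quotient_of x = (c, d)" by fastforce
  have d: "d > 0" using quotient_of_denom_pos[OF cd] .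
  have x: "x = of_int c / of_int d" using quotient_of_div[OF cd] .
  have "of_int (a * d) = (of_int (c * b) :: rat)"
    using x d assms unfolding x_def by (simp add: field_simps)
  hence eq: "a * d = c * b" by (simp only: of_int_eq_iff)
  have "c \<noteq> 0" using eq assms d by auto
  have pe: "prime_elem (int p)" using assms by auto
  have "multiplicity (int p) a + multiplicity (int p) d = multiplicity (int p) c + multiplicity (int p) b"
    using arg_cong[OF eq, of "multiplicity (int p)"] pe assms d \<open>c \<noteq> 0\<close>
    by (simp add: prime_elem_multiplicity_mult_distrib)
  thus ?thesis unfolding padic_val_def x_def[symmetric] cd by simp
qed

lemma multiplicity_int_nat: "multiplicity (int p) (int n) = multiplicity p n"
  unfolding multiplicity_def by (simp flip: of_nat_power)

lemma padic_val_of_nat: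
  assumes "prime p" "n \<noteq> 0"
  shows "padic_val p (of_nat n) = int (multiplicity p n)"
  using padic_val_divide_int[OF assms(1), of "int n" 1] assms(2) by (simp add: multiplicity_int_nat)

lemma rat_as_quotient:
  obtains a b :: int where "b \<noteq> 0" "(x :: rat) = of_int a / of_int b"
  by (metis quotient_of_div quotient_of_denom_pos less_irrefl surj_pair)

lemma padic_val_mult:
  assumes "prime p" "x \<noteq> 0" "y \<noteq> 0"
  shows "padic_val p (x * y) = padic_val p x + padic_val p y"
proof -
  obtain a b where x: "b \<noteq> 0" "x = of_int a / of_int b" by (rule rat_as_quotient)
  obtain c d where y: "d \<noteq> 0" "y = of_int c / of_int d" by (rule rat_as_quotient)
  have nz: "a \<noteq> 0" "c \<noteq> 0" using assms x y by auto
  have xy: "x * y = of_int (a * c) / of_int (b * d)" using x y by simp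
  have pe: "prime_elem (int p)" using assms by auto
  have "a * c \<noteq> 0" "b * d \<noteq> 0" using nz x y by auto
  show ?thesis
    unfolding xy padic_val_divide_int[OF assms(1) \<open>a * c \<noteq> 0\<close> \<open>b * d \<noteq> 0\<close>]
    unfolding x(2) y(2) padic_val_divide_int[OF assms(1) nz(1) x(1)]
      padic_val_divide_int[OF assms(1) nz(2) y(1)]
    using x(1) y(1) nz pe by (simp add: prime_elem_multiplicity_mult_distrib)
qed

lemma padic_val_inverse:
  assumes "prime p" "x \<noteq> 0"
  shows "padic_val p (inverse x) = - padic_val p x"
proof -
  have "padic_val p 1 = 0" using padic_val_of_nat[OF assms(1), of 1] by simp
  thus ?thesis using padic_val_mult[OF assms(1), of x "inverse x"] assms(2) by simp
qed

lemma padic_val_divide: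
  assumes "prime p" "x \<noteq> 0" "y \<noteq> 0"
  shows "padic_val p (x / y) = padic_val p x - padic_val p y"
  using padic_val_mult[OF assms(1), of x "inverse y"] padic_val_inverse[OF assms(1), of y] assms
  by (simp add: divide_inverse)

text \<open>Zero meets every bound, which replaces the junk value of \<open>padic_val\<close> at 0
  by infinity.\<close>

definition padic_ge :: "nat \<Rightarrow> int \<Rightarrow> rat \<Rightarrow> bool" where
  "padic_ge p e x \<longleftrightarrow> x = 0 \<or> e \<le> padic_val p x"

lemma padic_ge_0 [simp]: "padic_ge p e 0"
  by (simp add: padic_ge_def)

lemma padic_ge_mono: "padic_ge p e x \<Longrightarrow> e' \<le> e \<Longrightarrow> padic_ge p e' x"
  by (auto simp: padic_ge_def)

lemma padic_ge_mult:
  assumes "prime p" "padic_ge p e x" "padic_ge p e' y"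
  shows "padic_ge p (e + e') (x * y)"
  using assms padic_val_mult[OF assms(1), of x y]
  by (cases "x = 0"; cases "y = 0") (auto simp: padic_ge_def)

lemma padic_ge_add:
  assumes "prime p" "padic_ge p e x" "padic_ge p e y"
  shows "padic_ge p e (x + y)"
proof (cases "x = 0 \<or> y = 0 \<or> x + y = 0")
  case False
  obtain a b where x: "b \<noteq> 0" "x = of_int a / of_int b" by (rule rat_as_quotient)
  obtain c d where y: "d \<noteq> 0" "y = of_int c / of_int d" by (rule rat_as_quotient)
  have nz: "a \<noteq> 0" "c \<noteq> 0" using False x y by auto
  let ?v = "multiplicity (int p)"
  define M where "M = min (?v (a * d)) (?v (c * b))"
  have xy: "x + y = of_int (a * d + c * b) / of_int (b * d)"
    using x y by (simp add: field_simps)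
  hence nz2: "a * d + c * b \<noteq> 0" using False by (metis div_0 of_int_0)
  have pe: "prime_elem (int p)" using assms by auto
  have "int p ^ M dvd a * d + c * b"
    by (intro dvd_add multiplicity_dvd') (auto simp: M_def)
  hence M: "M \<le> ?v (a * d + c * b)"
    by (intro multiplicity_geI) (use nz2 pe prime_gt_1_nat[OF assms(1)] in auto)
  have "padic_val p x = int (?v a) - int (?v b)" "padic_val p y = int (?v c) - int (?v d)"
    "padic_val p (x + y) = int (?v (a * d + c * b)) - int (?v (b * d))"
    unfolding xy unfolding x(2) y(2) using x(1) y(1) nz nz2
    by (intro padic_val_divide_int assms(1); simp)+
  moreover have "?v (a * d) = ?v a + ?v d" "?v (c * b) = ?v c + ?v b" "?v (b * d) = ?v b + ?v d"
    using pe x y nz by (auto simp: prime_elem_multiplicity_mult_distrib)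
  ultimately show ?thesis
    using assms False M unfolding padic_ge_def M_def by (auto simp: min_def split: if_splits)
qed (use assms in \<open>auto simp: padic_ge_def\<close>)

lemma padic_ge_sum:
  assumes "prime p" "\<And>i. i \<in> A \<Longrightarrow> padic_ge p e (f i)"
  shows "padic_ge p e (sum f A)"
  using assms(2) by (induction A rule: infinite_finite_induct) (auto intro: padic_ge_add[OF assms(1)])

lemma padic_ge_of_int:
  assumes "prime p"
  shows "padic_ge p 0 (of_int a)"
  using padic_val_divide_int[OF assms, of a 1] by (cases "a = 0") (auto simp: padic_ge_def)

lemma padic_ge_of_nat:
  assumes "prime p"
  shows "padic_ge p 0 (of_nat n)"
  using padic_ge_of_int[OF assms, of "int n"] by simp

lemma padic_ge_minus:
  assumes "prime p" "padic_ge p e x"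
  shows "padic_ge p e (- x)"
  using padic_ge_mult[OF assms(1) padic_ge_of_int[OF assms(1), of "-1"] assms(2)] by simp

lemma padic_ge_diff:
  assumes "prime p" "padic_ge p e x" "padic_ge p e y"
  shows "padic_ge p e (x - y)"
  using padic_ge_add[OF assms(1,2) padic_ge_minus[OF assms(1,3)]] by simp

lemma padic_ge_sign:
  assumes "prime p"
  shows "padic_ge p e ((-1) ^ k * x) \<longleftrightarrow> padic_ge p e x"
  using padic_ge_minus[OF assms, of e x] padic_ge_minus[OF assms, of e "- x"]
  by (cases "even k") auto

lemma padic_ge_divide_of_nat:
  assumes "prime p" "n \<noteq> 0" "multiplicity p n \<le> v" "padic_ge p e x"
  shows "padic_ge p (e - int v) (x / of_nat n)"
  using padic_val_divide[OF assms(1), of x "of_nat n"] padic_val_of_nat[OF assms(1,2)] assms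
  by (cases "x = 0") (auto simp: padic_ge_def)

lemma padic_val_unique:
  assumes "padic_ge p e x" "\<not> padic_ge p (e + 1) x"
  shows "x \<noteq> 0" "padic_val p x = e"
  using assms by (auto simp: padic_ge_def)

text \<open>A summand of strictly smallest valuation decides the valuation of the sum. This is how
  dominant terms are isolated below.\<close>

lemma padic_val_add_higher:
  assumes "prime p" "x \<noteq> 0" "padic_val p x = e" "padic_ge p (e + 1) y"
  shows "x + y \<noteq> 0 \<and> padic_val p (x + y) = e"
proof -
  have "padic_ge p e x" "padic_ge p e y"
    using assms padic_ge_mono by (auto simp: padic_ge_def)
  hence "padic_ge p e (x + y)" by (intro padic_ge_add assms)
  moreover have "\<not> padic_ge p (e + 1) (x + y)"
  proof
    assume "padic_ge p (e + 1) (x + y)"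
    from padic_ge_diff[OF assms(1) this assms(4)] show False
      using assms(2,3) by (simp add: padic_ge_def)
  qed
  ultimately show ?thesis using padic_val_unique by blast
qed

section \<open>Integrality of power series\<close>

text \<open>The bound survives products because \<open>l div d + (i - l) div d\<close> never exceeds
  \<open>i div d\<close>.\<close>

lemma padic_ge_fps_mult:
  fixes f g :: "rat fps"
  assumes "prime p" "0 < d"
    and "\<And>i. padic_ge p (- int (i div d)) (fps_nth f i)"
    and "\<And>i. padic_ge p (- int (i div d)) (fps_nth g i)"
  shows "padic_ge p (- int (i div d)) (fps_nth (f * g) i)"
  unfolding fps_mult_nth
proof (intro padic_ge_sum[OF assms(1)])
  fix l assume "l \<in> {0..i}"
  hence "i = l + (i - l)" by simp
  hence "l div d + (i - l) div d \<le> i div d"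
    by (metis div_add1_eq le_add1)
  thus "padic_ge p (- int (i div d)) (fps_nth f l * fps_nth g (i - l))"
    by (intro padic_ge_mono[OF padic_ge_mult[OF assms(1) assms(3)[of l] assms(4)[of "i - l"]]]) simp
qed

lemma padic_ge_fps_power:
  fixes f :: "rat fps"
  assumes "prime p" "0 < d"
    and "\<And>i. padic_ge p (- int (i div d)) (fps_nth f i)"
  shows "padic_ge p (- int (i div d)) (fps_nth (f ^ k) i)"
proof (induction k arbitrary: i)
  case 0
  show ?case using padic_ge_of_nat[OF assms(1), of 1] by simp
next
  case (Suc k)
  show ?case
    unfolding power_Suc by (rule padic_ge_fps_mult[OF assms(1,2) assms(3) Suc])
qed

lemma padic_integral_fps_mult:
  fixes f g :: "rat fps"
  assumes "prime p"
    and "\<And>i. padic_ge p 0 (fps_nth f i)" "\<And>i. padic_ge p 0 (fps_nth g i)"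
  shows "padic_ge p 0 (fps_nth (f * g) i)"
  unfolding fps_mult_nth
  using padic_ge_mult[OF assms(1) assms(2) assms(3)] by (intro padic_ge_sum[OF assms(1)]) simp

lemma padic_integral_fps_power:
  fixes f :: "rat fps"
  assumes "prime p" and "\<And>i. padic_ge p 0 (fps_nth f i)"
  shows "padic_ge p 0 (fps_nth (f ^ k) i)"
proof (induction k arbitrary: i)
  case 0
  show ?case using padic_ge_of_nat[OF assms(1), of 1] by simp
next
  case (Suc k)
  show ?case
    unfolding power_Suc by (rule padic_integral_fps_mult[OF assms Suc])
qed

text \<open>With constant term 1, the recursion for the coefficients of the inverse involves no
  division.\<close>

lemma padic_integral_fps_inverse:
  fixes f :: "rat fps"
  assumes "prime p" and "\<And>i. padic_ge p 0 (fps_nth f i)" and "fps_nth f 0 = 1"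
  shows "padic_ge p 0 (fps_nth (inverse f) i)"
proof (induction i rule: less_induct)
  case (less i)
  show ?case
  proof (cases "i = 0")
    case True
    thus ?thesis using assms(3) padic_ge_of_nat[OF assms(1), of 1] by simp
  next
    case False
    have "(\<Sum>l=0..i. fps_nth f l * fps_nth (inverse f) (i - l)) = 0"
      using inverse_mult_eq_1'[of f] assms(3) False by (simp flip: fps_mult_nth)
    hence "fps_nth (inverse f) i = - (\<Sum>l=Suc 0..i. fps_nth f l * fps_nth (inverse f) (i - l))"
      using assms(3) by (simp add: sum.atLeast_Suc_atMost eq_neg_iff_add_eq_0)
    thus ?thesis
      using padic_ge_mult[OF assms(1) assms(2) less]
      by (auto intro!: padic_ge_minus padic_ge_sum assms(1))
  qed
qed

section \<open>Stirling numbers as coefficients of powers of X / log (1 + X)\<close>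

text \<open>The series \<open>log (1 + X) / X\<close>.\<close>

definition log_quot :: "rat fps" where
  "log_quot = Abs_fps (\<lambda>i. (-1) ^ i / of_nat (Suc i))"

lemma log_quot_nth_0 [simp]: "fps_nth log_quot 0 = 1"
  by (simp add: log_quot_def)

lemma one_plus_X_mult_nth:
  fixes f :: "'a :: comm_semiring_1 fps"
  shows "fps_nth ((1 + fps_X) * f) i = fps_nth f i + (if i = 0 then 0 else fps_nth f (i - 1))"
  by (simp add: distrib_right)

text \<open>The second factor is the derivative of \<open>X * log_quot = log (1 + X)\<close>, that
  is \<open>1 / (1 + X)\<close>.\<close>

lemma log_quot_deriv: "(1 + fps_X) * (log_quot + fps_X * fps_deriv log_quot) = 1"
proof (rule fps_ext)
  fix i
  have "fps_nth (log_quot + fps_X * fps_deriv log_quot) i = (-1) ^ i" for i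
  proof (cases i)
    case (Suc l)
    have "fps_nth (log_quot + fps_X * fps_deriv log_quot) i =
        (1 + of_nat (Suc l)) * ((-1) ^ i / of_nat (Suc i))"
      unfolding Suc distrib_right by (simp add: log_quot_def del: of_nat_Suc)
    also have "1 + of_nat (Suc l) = (of_nat (Suc i) :: rat)" by (simp add: Suc)
    finally show ?thesis by (simp del: of_nat_Suc)
  qed simp
  thus "fps_nth ((1 + fps_X) * (log_quot + fps_X * fps_deriv log_quot)) i = fps_nth 1 i"
    unfolding one_plus_X_mult_nth by (cases i) (simp_all only: power_Suc, simp_all)
qed

text \<open>Differentiating \<open>W ^ N\<close> and eliminating \<open>log_quot\<close> by
  \<open>log_quot_deriv\<close> links the powers \<open>N\<close> and \<open>Suc N\<close> linearly,
  as the Stirling recurrence requires.\<close>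

lemma log_quot_inverse_power_rec:
  defines "W \<equiv> inverse log_quot"
  shows "of_nat N * W ^ Suc N = (1 + fps_X) * (of_nat N * W ^ N - fps_X * fps_deriv (W ^ N))"
proof (cases N)
  case (Suc M)
  have WL: "W * log_quot = 1" unfolding W_def by (rule inverse_mult_eq_1) simp
  have W': "fps_deriv W = - fps_deriv log_quot * W\<^sup>2"
    unfolding W_def by (rule fps_inverse_deriv) simp
  have "fps_deriv (W ^ N) = of_nat N * fps_deriv W * W ^ M"
    using fps_deriv_power'[of W N] Suc by simp
  also have "\<dots> = - (of_nat N * fps_deriv log_quot * W ^ Suc N)"
    unfolding W' Suc by (simp add: power2_eq_square algebra_simps)
  finally have d: "fps_deriv (W ^ N) = - (of_nat N * fps_deriv log_quot * W ^ Suc N)" .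
  have "W ^ N = W ^ Suc N * log_quot"
    using WL by (simp add: algebra_simps)
  hence "of_nat N * W ^ N - fps_X * fps_deriv (W ^ N) =
      of_nat N * W ^ Suc N * (log_quot + fps_X * fps_deriv log_quot)"
    unfolding d by (simp only:) (simp add: algebra_simps)
  hence "(1 + fps_X) * (of_nat N * W ^ N - fps_X * fps_deriv (W ^ N)) =
      of_nat N * W ^ Suc N * ((1 + fps_X) * (log_quot + fps_X * fps_deriv log_quot))"
    by (simp only: mult_ac)
  thus ?thesis unfolding log_quot_deriv by simp
qed simp

text \<open>The operator \<open>N - X d/dX\<close> multiplies the coefficient of
  \<open>X ^ i\<close> by \<open>N - i\<close>.\<close>

lemma log_quot_inverse_power_nth_rec:
  defines "W \<equiv> inverse log_quot"
  shows "of_nat N * fps_nth (W ^ Suc N) (Suc j) =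
    (of_nat N - of_nat (Suc j)) * fps_nth (W ^ N) (Suc j) + (of_nat N - of_nat j) * fps_nth (W ^ N) j"
proof -
  have nth: "fps_nth (of_nat N * W ^ N - fps_X * fps_deriv (W ^ N)) i =
      (of_nat N - of_nat i) * fps_nth (W ^ N) i" for i
    by (cases i) (simp_all add: fps_of_nat[symmetric] algebra_simps del: of_nat_Suc)
  have "of_nat N * fps_nth (W ^ Suc N) (Suc j) = fps_nth (of_nat N * W ^ Suc N) (Suc j)"
    by (simp add: fps_of_nat[symmetric] del: power_Suc)
  also have "\<dots> = fps_nth ((1 + fps_X) * (of_nat N * W ^ N - fps_X * fps_deriv (W ^ N))) (Suc j)"
    unfolding W_def by (simp only: log_quot_inverse_power_rec)
  finally show ?thesis
    unfolding one_plus_X_mult_nth nth by simp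
qed

text \<open>Both sides satisfy the same recurrence in \<open>n\<close>, by
  \<open>log_quot_inverse_power_nth_rec\<close>, with the same boundary value 1 at
  \<open>k = n\<close>.\<close>

lemma Stirling_eq_log_quot_coeff:
  assumes "k \<le> n"
  shows "of_nat (Stirling (Suc n) (Suc k)) =
    fact n / fact k * fps_nth (inverse log_quot ^ Suc n) (n - k)"
  using assms
proof (induction n arbitrary: k)
  case 0
  thus ?case by simp
next
  case (Suc n)
  define W where "W = inverse log_quot"
  have W0: "fps_nth (W ^ i) 0 = 1" for i by (simp add: W_def fps_nth_power_0)
  show ?case
  proof (cases "k = Suc n")
    case True
    thus ?thesis using W0[of "Suc (Suc n)"] by (simp add: W_def)
  next
    case False
    define j where "j = n - k"
    have k: "k \<le> n" "Suc n - k = Suc j" "n = k + j" using False Suc.prems by (auto simp: j_def)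
    have rec: "of_nat (Suc n) * fps_nth (W ^ Suc (Suc n)) (Suc j) =
        of_nat k * fps_nth (W ^ Suc n) (Suc j) + of_nat (Suc k) * fps_nth (W ^ Suc n) j"
      using log_quot_inverse_power_nth_rec[of "Suc n" j] k(3) by (simp add: W_def)
    have a: "of_nat (Stirling (Suc n) (Suc k)) = fact n / fact k * fps_nth (W ^ Suc n) j"
      using Suc.IH[OF k(1)] by (simp add: W_def j_def)
    \<comment> \<open>For \<open>k = 0\<close> both sides vanish; otherwise this is the induction
      hypothesis at \<open>k - 1\<close>, whose \<open>fact (k - 1)\<close> becomes
      \<open>fact k / k\<close>.\<close>
    have b: "of_nat (Stirling (Suc n) k) = fact n / fact k * of_nat k * fps_nth (W ^ Suc n) (Suc j)"
    proof (cases k)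
      case (Suc k')
      have "n - k' = Suc j" "k' \<le> n" using k Suc by auto
      thus ?thesis using Suc.IH[of k'] by (simp add: W_def Suc del: power_Suc of_nat_Suc)
    qed simp
    have S: "Stirling (Suc (Suc n)) (Suc k) = Suc k * Stirling (Suc n) (Suc k) + Stirling (Suc n) k"
      by (rule Stirling.simps)
    have "of_nat (Stirling (Suc (Suc n)) (Suc k)) =
        fact n / fact k * (of_nat k * fps_nth (W ^ Suc n) (Suc j) + of_nat (Suc k) * fps_nth (W ^ Suc n) j)"
      unfolding S of_nat_add of_nat_mult a b by (simp only: algebra_simps)
    also have "\<dots> = fact (Suc n) / fact k * fps_nth (W ^ Suc (Suc n)) (Suc j)"
      unfolding rec[symmetric] by (simp del: power_Suc)
    finally show ?thesis using k(2) by (simp only: W_def)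
  qed
qed

section \<open>Isolating the denominators of log (1 + X) / X\<close>

lemma fps_compose_X_power_nth:
  fixes f :: "'a :: comm_ring_1 fps"
  assumes "0 < d"
  shows "fps_nth (f oo fps_X ^ d) i = (if d dvd i then fps_nth f (i div d) else 0)"
proof -
  have "fps_nth (f oo fps_X ^ d) i = (\<Sum>l=0..i. if l * d = i then fps_nth f l else 0)"
    by (simp add: fps_compose_nth flip: power_mult) (intro sum.cong; simp add: mult.commute)
  also have "\<dots> = (if d dvd i then fps_nth f (i div d) else 0)"
  proof (cases "d dvd i")
    case True
    have "(\<Sum>l=0..i. if l * d = i then fps_nth f l else 0) = (\<Sum>l=0..i. if l = i div d then fps_nth f l else 0)"
      using True assms by (intro sum.cong refl) auto
    thus ?thesis using True by (simp add: sum.delta)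
  qed (auto intro!: sum.neutral)
  finally show ?thesis .
qed

text \<open>As \<open>h\<close> has no constant term, \<open>h ^ s\<close> starts in degree
  \<open>s\<close>; all inner sums may thus run up to \<open>i\<close> and be interchanged.\<close>

lemma fps_mult_compose_nth:
  fixes f g h :: "'a :: comm_ring_1 fps"
  assumes "fps_nth h 0 = 0"
  shows "fps_nth (f * (g oo h)) i = (\<Sum>s=0..i. fps_nth g s * fps_nth (f * h ^ s) i)"
proof -
  have "fps_nth (g oo h) (i - l) = (\<Sum>s=0..i. fps_nth g s * fps_nth (h ^ s) (i - l))" for l
    unfolding fps_compose_nth using assms startsby_zero_power_prefix[of h]
    by (intro sum.mono_neutral_left) auto
  hence "fps_nth (f * (g oo h)) i =
      (\<Sum>l=0..i. \<Sum>s=0..i. fps_nth f l * (fps_nth g s * fps_nth (h ^ s) (i - l)))"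
    by (simp add: fps_mult_nth sum_distrib_left)
  also have "\<dots> = (\<Sum>s=0..i. \<Sum>l=0..i. fps_nth f l * (fps_nth g s * fps_nth (h ^ s) (i - l)))"
    by (rule sum.swap)
  finally show ?thesis
    by (simp add: fps_mult_nth sum_distrib_left mult_ac)
qed

definition log_unit_part :: "nat \<Rightarrow> rat fps" where
  "log_unit_part p = Abs_fps (\<lambda>i. if p dvd Suc i then 0 else (-1) ^ i / of_nat (Suc i))"

text \<open>The degrees with \<open>p\<close> dividing the denominator are
  \<open>p - 1 + p * c\<close>, with denominator \<open>p * Suc c\<close>. This series keeps what
  remains after removing \<open>X ^ (p - 1)\<close>, one factor \<open>1 / p\<close> and a sign, and
  reading \<open>X ^ p\<close> as \<open>X\<close>.\<close>

definition log_pole_part :: "nat \<Rightarrow> rat fps" where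
  "log_pole_part p = Abs_fps (\<lambda>c. (-1) ^ (p * c) / of_nat (Suc c))"

lemma log_quot_split:
  assumes "0 < p"
  shows "log_quot = log_unit_part p +
    fps_const ((-1) ^ (p - 1) / of_nat p) * (fps_X ^ (p - 1) * (log_pole_part p oo fps_X ^ p))"
proof (rule fps_ext)
  fix i
  show "fps_nth log_quot i = fps_nth (log_unit_part p +
    fps_const ((-1) ^ (p - 1) / of_nat p) * (fps_X ^ (p - 1) * (log_pole_part p oo fps_X ^ p))) i"
  proof (cases "p dvd Suc i")
    case True
    then obtain c' where c': "Suc i = p * c'" by auto
    then obtain c where "c' = Suc c" by (cases c') auto
    with c' assms have i: "i = (p - 1) + p * c" "Suc i = p * Suc c" by auto
    have "fps_nth log_quot i = (-1) ^ (p - 1) / of_nat p * fps_nth (log_pole_part p) c"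
      unfolding log_quot_def log_pole_part_def fps_nth_Abs_fps i(2) unfolding i(1)
      by (simp only: power_add of_nat_mult times_divide_times_eq)
    moreover have "fps_nth (fps_X ^ (p - 1) * (log_pole_part p oo fps_X ^ p)) i = fps_nth (log_pole_part p) c"
      using assms unfolding i(1) fps_X_power_mult_nth fps_compose_X_power_nth[OF assms] by simp
    ultimately show ?thesis
      using True by (simp add: log_unit_part_def)
  next
    case False
    have "\<not> p dvd i - (p - 1)" if "p - 1 \<le> i"
    proof
      assume "p dvd i - (p - 1)"
      hence "p dvd (i - (p - 1)) + p" by simp
      also have "(i - (p - 1)) + p = Suc i" using that assms by simp
      finally show False using False by simp
    qed
    thus ?thesis
      using assms False
      by (auto simp: log_quot_def log_unit_part_def fps_X_power_mult_nth fps_compose_X_power_nth)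
  qed
qed

text \<open>What is left of the \<open>s\<close>-th term of the binomial expansion once the binomial
  coefficient, the sign, \<open>1 / p ^ s\<close> and \<open>X ^ ((p - 1) * s)\<close> are taken
  out.\<close>

definition expansion_cofactor :: "nat \<Rightarrow> nat \<Rightarrow> nat \<Rightarrow> nat \<Rightarrow> rat" where
  "expansion_cofactor p n s t = fps_nth
    ((log_pole_part p ^ s oo fps_X ^ p) * inverse (log_unit_part p) ^ (Suc n + s)) t"

lemma log_unit_part_nth_0:
  assumes "prime p"
  shows "fps_nth (log_unit_part p) 0 = 1"
  using assms by (auto simp: log_unit_part_def)

lemma expansion_cofactor_0:
  assumes "prime p"
  shows "expansion_cofactor p n s 0 = 1"
  by (simp add: expansion_cofactor_def fps_nth_power_0 log_unit_part_nth_0[OF assms] log_pole_part_def)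

text \<open>Write \<open>log_quot = log_unit_part p * (1 - V)\<close>, where \<open>V\<close>
  carries the factor \<open>X ^ (p - 1) / p\<close>, and expand \<open>(1 - V)\<close> to the power
  \<open>- (n + 1)\<close>.\<close>

lemma log_quot_inverse_power_expansion:
  assumes "prime p"
  shows "fps_nth (inverse log_quot ^ Suc n) i =
    (\<Sum>s=0..i. if (p - 1) * s \<le> i
      then of_nat ((n + s) choose s) * ((-1) ^ (p * s) / of_nat p ^ s) *
        expansion_cofactor p n s (i - (p - 1) * s)
      else 0)"
proof -
  have p2: "2 \<le> p" using assms by (rule prime_ge_2_nat)
  define Q where "Q = inverse (log_unit_part p)"
  define A where "A = log_pole_part p oo fps_X ^ p"
  define c :: rat where "c = (-1) ^ p / of_nat p"
  define V where "V = fps_const c * (fps_X ^ (p - 1) * A) * Q"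
  define G :: "rat fps" where "G = Abs_fps (\<lambda>s. of_nat ((n + s) choose s))"
  have Q0: "fps_nth Q 0 = 1" using log_unit_part_nth_0[OF assms] by (simp add: Q_def)
  have QU: "Q * log_unit_part p = 1"
    unfolding Q_def by (rule inverse_mult_eq_1) (simp add: log_unit_part_nth_0[OF assms])
  have V0: "fps_nth V 0 = 0" using p2 by (simp add: V_def)
  have c': "(-1) ^ (p - 1) / of_nat p = - c" using p2 by (cases p) (auto simp: c_def)
  have "Q * log_quot = 1 - V"
    unfolding log_quot_split[OF prime_gt_0_nat[OF assms]] c' using QU
    by (simp add: V_def A_def algebra_simps flip: fps_const_neg)
  hence L: "log_quot = log_unit_part p * (1 - V)"
    using QU by (metis mult.assoc mult.commute mult_1)
  have W: "inverse log_quot = Q * inverse (1 - V)"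
    unfolding L by (simp add: fps_inverse_mult Q_def)
  \<comment> \<open>\<open>G\<close> is the negative binomial series of exponent
    \<open>- (n + 1)\<close>; composing it with \<open>V\<close> gives the expansion.\<close>
  have "inverse ((1 - fps_const 1 * fps_X) ^ Suc n) = G"
    using one_minus_const_fps_X_neg_power'[of "Suc n" "1 :: rat"] by (simp add: G_def)
  hence "G oo V = inverse ((1 - fps_X) ^ Suc n) oo V" by simp
  also have "\<dots> = inverse ((1 - fps_X) ^ Suc n oo V)"
    by (rule fps_inverse_compose) (simp_all add: V0 fps_nth_power_0 del: power_Suc)
  also have "(1 - fps_X) ^ Suc n oo V = (1 - V) ^ Suc n"
    by (simp only: fps_compose_power[OF V0, symmetric] fps_compose_sub_distrib
        fps_compose_1 fps_X_fps_compose_startby0[OF V0])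
  finally have G: "G oo V = inverse (1 - V) ^ Suc n"
    by (simp only: fps_inverse_power)
  have "fps_nth (inverse log_quot ^ Suc n) i = fps_nth (Q ^ Suc n * (G oo V)) i"
    unfolding W G power_mult_distrib ..
  also have "\<dots> = (\<Sum>s=0..i. fps_nth G s * fps_nth (Q ^ Suc n * V ^ s) i)"
    by (rule fps_mult_compose_nth[OF V0])
  also have "\<dots> = (\<Sum>s=0..i. if (p - 1) * s \<le> i
      then of_nat ((n + s) choose s) * ((-1) ^ (p * s) / of_nat p ^ s) *
        expansion_cofactor p n s (i - (p - 1) * s)
      else 0)"
  proof (intro sum.cong refl)
    fix s
    have As: "A ^ s = log_pole_part p ^ s oo fps_X ^ p"
      unfolding A_def by (rule fps_compose_power) (use p2 in simp)
    have "Q ^ Suc n * V ^ s = fps_const (c ^ s) * (fps_X ^ ((p - 1) * s) * (A ^ s * Q ^ (Suc n + s)))"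
      unfolding V_def power_mult_distrib power_add power_mult[symmetric]
      by (simp add: algebra_simps fps_const_power power_mult power_mult_distrib)
    hence "fps_nth (Q ^ Suc n * V ^ s) i =
        fps_nth (fps_const (c ^ s) * (fps_X ^ ((p - 1) * s) * (A ^ s * Q ^ (Suc n + s)))) i"
      by (rule arg_cong)
    also have "\<dots> = (if (p - 1) * s \<le> i then c ^ s * expansion_cofactor p n s (i - (p - 1) * s) else 0)"
      unfolding fps_mult_left_const_nth fps_X_power_mult_nth expansion_cofactor_def As Q_def by simp
    finally have "fps_nth (Q ^ Suc n * V ^ s) i = \<dots>" .
    thus "fps_nth G s * fps_nth (Q ^ Suc n * V ^ s) i = (if (p - 1) * s \<le> i
      then of_nat ((n + s) choose s) * ((-1) ^ (p * s) / of_nat p ^ s) *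
        expansion_cofactor p n s (i - (p - 1) * s)
      else 0)"
      by (simp add: G_def c_def power_divide power_mult)
  qed
  finally show ?thesis .
qed

text \<open>In \<open>digit_sum_Suc\<close> the digit sum of \<open>c\<close> is at most
  \<open>c\<close> and that of \<open>Suc c\<close> at least 1.\<close>

lemma multiplicity_Suc_le:
  assumes "prime p"
  shows "multiplicity p (Suc c) \<le> c div (p - 1)"
proof -
  have p2: "2 \<le> p" using assms by (rule prime_ge_2_nat)
  have "(p - 1) * multiplicity p (Suc c) \<le> c"
    using digit_sum_Suc[OF assms, of c] digit_sum_le[OF assms, of c] digit_sum_pos[OF p2, of "Suc c"]
    by linarith
  thus ?thesis using p2 by (simp add: less_eq_div_iff_mult_less_eq mult.commute)
qed

lemma padic_ge_log_pole_part_power: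
  assumes "prime p"
  shows "padic_ge p (- int (b div (p - 1))) (fps_nth (log_pole_part p ^ s) b)"
proof (rule padic_ge_fps_power[OF assms])
  show "0 < p - 1" using prime_gt_1_nat[OF assms] by simp
  show "padic_ge p (- int (i div (p - 1))) (fps_nth (log_pole_part p) i)" for i
    using padic_ge_divide_of_nat[OF assms _ multiplicity_Suc_le[OF assms, of i], of 0 "(-1) ^ (p * i)"]
      padic_ge_of_int[OF assms, of "(-1) ^ (p * i)"]
    by (simp add: log_pole_part_def del: of_nat_Suc)
qed

lemma padic_ge_log_unit_part_inverse_power:
  assumes "prime p"
  shows "padic_ge p 0 (fps_nth (inverse (log_unit_part p) ^ s) i)"
proof (intro padic_integral_fps_power padic_integral_fps_inverse assms)
  show "padic_ge p 0 (fps_nth (log_unit_part p) i)" for i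
    using padic_ge_divide_of_nat[OF assms, of "Suc i" 0 0 "(-1) ^ i"]
      padic_ge_of_int[OF assms, of "(-1) ^ i"] not_dvd_imp_multiplicity_0[of p "Suc i"]
    by (auto simp: log_unit_part_def simp del: of_nat_Suc)
qed (rule log_unit_part_nth_0[OF assms])

text \<open>The powers of \<open>inverse (log_unit_part p)\<close> are \<open>p\<close>-integral, so
  only the coefficients of \<open>log_pole_part p ^ s\<close> that reach degree \<open>t\<close>
  after \<open>X\<close> becomes \<open>X ^ p\<close> matter.\<close>

lemma padic_ge_expansion_cofactor:
  assumes "prime p"
    and "\<And>b. p * b \<le> t \<Longrightarrow> padic_ge p e (x * fps_nth (log_pole_part p ^ s) b)"
  shows "padic_ge p e (x * expansion_cofactor p n s t)"
  unfolding expansion_cofactor_def fps_mult_nth sum_distrib_left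
proof (intro padic_ge_sum[OF assms(1)])
  fix a assume a: "a \<in> {0..t}"
  have "padic_ge p e (x * fps_nth (log_pole_part p ^ s oo fps_X ^ p) a)"
    using assms(2)[of "a div p"] a prime_gt_0_nat[OF assms(1)]
    by (auto simp: fps_compose_X_power_nth)
  from padic_ge_mult[OF assms(1) this padic_ge_log_unit_part_inverse_power[OF assms(1), of "Suc n + s" "t - a"]]
  show "padic_ge p e (x * (fps_nth (log_pole_part p ^ s oo fps_X ^ p) a *
      fps_nth (inverse (log_unit_part p) ^ (Suc n + s)) (t - a)))"
    by (simp add: mult.assoc)
qed

section \<open>Coefficients of the Bernoulli polynomials\<close>

text \<open>The exponential generating function of the Stirling numbers: the derivative of
  \<open>f ^ k\<close> is \<open>k * (f ^ k + f ^ (k - 1))\<close> for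
  \<open>f = fps_exp 1 - 1\<close>, which is their recurrence.\<close>

lemma fps_exp_minus_1_power_nth:
  "fps_nth ((fps_exp 1 - 1 :: rat fps) ^ k) m = fact k * of_nat (Stirling m k) / fact m"
proof (induction m arbitrary: k)
  case 0
  show ?case by (cases k) (auto simp: fps_nth_power_0)
next
  case (Suc m)
  show ?case
  proof (cases k)
    case (Suc k')
    let ?f = "fps_exp 1 - 1 :: rat fps"
    have "of_nat (Suc m) * fps_nth (?f ^ k) (Suc m) = fps_nth (fps_deriv (?f ^ k)) m"
      by simp
    also have "fps_deriv (?f ^ k) = of_nat k * (?f ^ k + ?f ^ k')"
      unfolding fps_deriv_power' Suc by (simp add: algebra_simps)
    also have "fps_nth \<dots> m = of_nat k * (fps_nth (?f ^ k) m + fps_nth (?f ^ k') m)"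
      by (simp add: fps_of_nat[symmetric])
    also have "\<dots> = of_nat k * ((fact k * of_nat (Stirling m k) + fact k' * of_nat (Stirling m k')) / fact m)"
      unfolding Suc.IH by (simp add: add_divide_distrib)
    also have "\<dots> = fact k * of_nat (Stirling (Suc m) k) / fact m"
      unfolding Suc by (simp add: field_simps)
    also have "\<dots> = of_nat (Suc m) * (fact k * of_nat (Stirling (Suc m) k) / fact (Suc m))"
      by (simp del: Stirling.simps of_nat_Suc)
    finally show ?thesis by (simp only: mult_cancel_left of_nat_eq_0_iff) simp
  qed simp
qed

lemma bernoulli_gf_factor_nth:
  "fps_nth ((fps_X / (fps_exp 1 - 1) :: rat fps) powi (- int k)) i =
    fact k * of_nat (Stirling (i + k) k) / fact (i + k)"
proof -
  define H :: "rat fps" where "H = Abs_fps (\<lambda>i. 1 / fact (Suc i))"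
  have H0: "fps_nth H 0 = 1" by (simp add: H_def)
  have exp: "fps_exp 1 - 1 = fps_X * H"
    by (rule fps_ext) (auto simp: H_def gr0_conv_Suc)
  \<comment> \<open>The denominator is not a unit, so the numerator is first exhibited as a multiple
    of it.\<close>
  have "fps_X / (fps_exp 1 - 1) = (inverse H * (fps_X * H)) / (fps_X * H)"
    using inverse_mult_eq_1[of H] H0 by (simp add: exp mult.left_commute)
  also have "\<dots> = inverse H"
    using H0 by (intro nonzero_mult_div_cancel_right) auto
  finally have "(fps_X / (fps_exp 1 - 1) :: rat fps) powi (- int k) = inverse (inverse H) ^ k"
    by (auto simp: power_int_def)
  also have "\<dots> = H ^ k"
    using H0 by simp
  finally have "fps_nth ((fps_X / (fps_exp 1 - 1) :: rat fps) powi (- int k)) i =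
      fps_nth (fps_X ^ k * H ^ k) (i + k)"
    by (simp add: fps_X_power_mult_nth)
  thus ?thesis
    by (simp add: power_mult_distrib[symmetric] exp[symmetric] fps_exp_minus_1_power_nth)
qed

lemma coeff_bernoulli_poly:
  assumes "k \<le> n"
  shows "coeff (bernoulli_poly (n - k) (- int k)) d =
    of_nat ((n choose d) * Stirling (n - d) k) / of_nat (n choose k)"
proof (cases "d \<le> n - k")
  case False
  have zero: "(n choose d) * Stirling (n - d) k = 0" using False assms by (cases "d \<le> n") auto
  show ?thesis
    unfolding zero using False
    by (auto simp: bernoulli_poly_def bernoulli_gf_def fps_mult_nth coeff_sum intro!: sum.neutral)
next
  case True
  define N where "N = n - k"
  define g where "g = (\<lambda>i. fps_nth ((fps_X / (fps_exp 1 - 1) :: rat fps) powi (- int k)) i)"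
  have d: "d \<le> N" "n - d = (N - d) + k" "n - d \<le> n" "k \<le> n" using True assms by (auto simp: N_def)
  have "coeff (bernoulli_poly N (- int k)) d =
      fact N * (\<Sum>i=0..N. g i * (if N - i = d then 1 / fact (N - i) else 0))"
    by (simp add: bernoulli_poly_def bernoulli_gf_def fps_mult_nth coeff_sum g_def)
  also have "(\<Sum>i=0..N. g i * (if N - i = d then 1 / fact (N - i) else 0)) =
      (\<Sum>i=0..N. if i = N - d then g i / fact d else 0)"
    using d(1) by (intro sum.cong refl) auto
  also have "\<dots> = g (N - d) / fact d" by (simp add: sum.delta)
  also have "g (N - d) = fact k * of_nat (Stirling (n - d) k) / fact (n - d)"
    unfolding g_def bernoulli_gf_factor_nth d(2) ..
  also have "fact N * (fact k * of_nat (Stirling (n - d) k) / fact (n - d) / fact d) =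
      of_nat (Stirling (n - d) k) * (fact n / (fact d * fact (n - d))) / (fact n / (fact k * fact N) :: rat)"
    by (simp add: mult_ac)
  also have "\<dots> = of_nat ((n choose d) * Stirling (n - d) k) / of_nat (n choose k)"
    using d True assms by (simp add: binomial_fact N_def)
  finally show ?thesis by (simp add: N_def)
qed

section \<open>Change of basis\<close>

text \<open>
  With \<open>F n k x = (\<Sum>d. (n choose d) * Stirling (n - d) k * x ^ d)\<close>, which is
  \<open>\<Delta>\<^sup>k x\<^sup>n / k!\<close>, these are the coefficients of \<open>F n k\<close> in the basis \<open>(x - 1) \<dots> (x - l)\<close>.
\<close>

definition shifted_coeff :: "nat \<Rightarrow> nat \<Rightarrow> nat \<Rightarrow> nat" where
  "shifted_coeff n k l = ((k + l) choose l) * Stirling (Suc n) (Suc (k + l))"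

text \<open>Mirrors \<open>F (n + 1) k = (x + k) * F n k + F n (k - 1)\<close>, with
  \<open>x + k\<close> split as \<open>(x - (l + 1)) + (k + l + 1)\<close> when it multiplies
  \<open>(x - 1) ... (x - l)\<close>. The proof combines Pascal's rule with the Stirling
  recurrence.\<close>

lemma shifted_coeff_rec:
  "shifted_coeff (Suc n) k l = (k + l + 1) * shifted_coeff n k l +
    (if l = 0 then 0 else shifted_coeff n k (l - 1)) +
    (if k = 0 then 0 else shifted_coeff n (k - 1) l)"
proof -
  have S: "Stirling (Suc (Suc n)) (Suc (k + l)) =
      Suc (k + l) * Stirling (Suc n) (Suc (k + l)) + Stirling (Suc n) (k + l)"
    by (rule Stirling.simps)
  show ?thesis
  proof (cases l)
    case 0
    thus ?thesis unfolding shifted_coeff_def S by (cases k) auto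
  next
    case l: (Suc l')
    show ?thesis
    proof (cases k)
      case 0
      thus ?thesis using l unfolding shifted_coeff_def S by simp
    next
      case (Suc k')
      have "(k + l) choose l = ((k + l') choose l') + ((k' + l) choose l)"
        unfolding l Suc by simp
      moreover have "k + l = Suc (k + l')" "k + l = Suc (k' + l)" using l Suc by auto
      ultimately show ?thesis
        using l Suc unfolding shifted_coeff_def S by (simp add: algebra_simps del: Stirling.simps)
    qed
  qed
qed

text \<open>The signed first-kind number is the coefficient of \<open>x ^ d\<close> in
  \<open>(x - 1) ... (x - l)\<close>. The identity thus reads off the coefficient of
  \<open>x ^ d\<close> in \<open>x + k\<close> times a polynomial given in that basis.\<close>

lemma stirling_signed_sum:
  fixes y :: "nat \<Rightarrow> int"
  assumes "y (Suc n) = 0"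
  shows "(\<Sum>l\<le>Suc n. (-1) ^ (l + d) * int (stirling (Suc l) (Suc d)) *
      ((int k + int l + 1) * y l + (if l = 0 then 0 else y (l - 1)))) =
    int k * (\<Sum>l\<le>n. (-1) ^ (l + d) * int (stirling (Suc l) (Suc d)) * y l) +
    (\<Sum>l\<le>n. (-1) ^ (l + d + 1) * int (stirling (Suc l) d) * y l)"
proof -
  let ?b = "\<lambda>d l. (-1) ^ (l + d) * int (stirling (Suc l) (Suc d))"
  have "(\<Sum>l\<le>Suc n. ?b d l * ((int k + int l + 1) * y l + (if l = 0 then 0 else y (l - 1)))) =
      (\<Sum>l\<le>Suc n. ?b d l * ((int k + int l + 1) * y l)) +
      (\<Sum>l\<le>Suc n. ?b d l * (if l = 0 then 0 else y (l - 1)))"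
    by (simp only: distrib_left sum.distrib)
  also have "(\<Sum>l\<le>Suc n. ?b d l * ((int k + int l + 1) * y l)) =
      (\<Sum>l\<le>n. ?b d l * ((int k + int l + 1) * y l))"
    using assms by simp
  also have "(\<Sum>l\<le>Suc n. ?b d l * (if l = 0 then 0 else y (l - 1))) = (\<Sum>l\<le>n. ?b d (Suc l) * y l)"
    by (subst sum.atMost_Suc_shift) simp
  finally have "(\<Sum>l\<le>Suc n. ?b d l * ((int k + int l + 1) * y l + (if l = 0 then 0 else y (l - 1)))) =
      (\<Sum>l\<le>n. ?b d l * ((int k + int l + 1) * y l) + ?b d (Suc l) * y l)"
    by (simp only: sum.distrib)
  also have "\<dots> = (\<Sum>l\<le>n. int k * (?b d l * y l) + (-1) ^ (l + d + 1) * int (stirling (Suc l) d) * y l)"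
  proof (intro sum.cong refl)
    fix l
    have "stirling (Suc (Suc l)) (Suc d) = Suc l * stirling (Suc l) (Suc d) + stirling (Suc l) d"
      by (rule stirling.simps)
    thus "?b d l * ((int k + int l + 1) * y l) + ?b d (Suc l) * y l =
        int k * (?b d l * y l) + (-1) ^ (l + d + 1) * int (stirling (Suc l) d) * y l"
      by (simp add: algebra_simps del: stirling.simps)
  qed
  finally show ?thesis
    by (simp only: sum.distrib sum_distrib_left)
qed

lemma binomial_Stirling_eq_sum_shifted_coeff:
  "int ((n choose d) * Stirling (n - d) k) =
    (\<Sum>l\<le>n. (-1) ^ (l + d) * int (stirling (Suc l) (Suc d)) * int (shifted_coeff n k l))"
proof (induction n arbitrary: d k)
  case 0
  show ?case by (cases d; cases k) (auto simp: shifted_coeff_def)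
next
  case (Suc n)
  let ?b = "\<lambda>d l. (-1) ^ (l + d) * int (stirling (Suc l) (Suc d))"
  let ?g = "\<lambda>n k d. int ((n choose d) * Stirling (n - d) k)"
  \<comment> \<open>Allows sums up to \<open>Suc n\<close> to be cut at \<open>n\<close>, where the
    induction hypothesis applies.\<close>
  have top: "shifted_coeff n k' (Suc n) = 0" for k'
    by (simp add: shifted_coeff_def)
  have "(\<Sum>l\<le>Suc n. ?b d l * int (shifted_coeff (Suc n) k l)) =
    (\<Sum>l\<le>Suc n. ?b d l * ((int k + int l + 1) * int (shifted_coeff n k l) +
        (if l = 0 then 0 else int (shifted_coeff n k (l - 1))))) +
    (\<Sum>l\<le>Suc n. ?b d l * (if k = 0 then 0 else int (shifted_coeff n (k - 1) l)))"
    unfolding sum.distrib[symmetric]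
    by (intro sum.cong refl) (subst shifted_coeff_rec, simp add: algebra_simps)
  also have "(\<Sum>l\<le>Suc n. ?b d l * (if k = 0 then 0 else int (shifted_coeff n (k - 1) l))) =
      (if k = 0 then 0 else ?g n (k - 1) d)"
    using Suc.IH[of d "k - 1"] top by simp
  also have "(\<Sum>l\<le>Suc n. ?b d l * ((int k + int l + 1) * int (shifted_coeff n k l) +
        (if l = 0 then 0 else int (shifted_coeff n k (l - 1))))) =
      int k * ?g n k d + (\<Sum>l\<le>n. (-1) ^ (l + d + 1) * int (stirling (Suc l) d) * int (shifted_coeff n k l))"
    unfolding Suc.IH by (rule stirling_signed_sum) (simp add: top)
  also have "(\<Sum>l\<le>n. (-1) ^ (l + d + 1) * int (stirling (Suc l) d) * int (shifted_coeff n k l)) =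
      (if d = 0 then 0 else ?g n k (d - 1))"
    by (cases d) (simp_all only: Suc.IH, simp_all)
  also have "int k * ?g n k d + (if d = 0 then 0 else ?g n k (d - 1)) + (if k = 0 then 0 else ?g n (k - 1) d) =
      ?g (Suc n) k d"
  proof -
    have *: "int k * ?g n k d + (if k = 0 then 0 else ?g n (k - 1) d) = int ((n choose d) * Stirling (Suc n - d) k)"
    proof (cases "d \<le> n")
      case True
      hence "Suc n - d = Suc (n - d)" by simp
      thus ?thesis by (cases k) (simp_all add: algebra_simps)
    qed simp
    show ?thesis
      using * by (cases d) (auto simp: algebra_simps)
  qed
  finally show ?case by simp
qed

section \<open>Poles of the coefficients\<close>

lemma padic_ge_of_nat_multiplicity:
  assumes "prime p" "v \<le> multiplicity p x"
  shows "padic_ge p (int v) (of_nat x)"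
  using padic_val_of_nat[OF assms(1), of x] assms(2) by (cases "x = 0") (auto simp: padic_ge_def)

lemma multiplicity_fact_mono:
  assumes "prime p" "x \<le> y"
  shows "multiplicity p (fact x :: nat) \<le> multiplicity p (fact y :: nat)"
  using assms by (intro dvd_imp_multiplicity_le fact_dvd) auto

text \<open>Legendre's formula with equal digit sums of \<open>p * b\<close> and \<open>b\<close>:
  the surplus over \<open>b\<close> is the multiplicity of \<open>p\<close> in
  \<open>fact b\<close>, positive once \<open>p \<le> b\<close>.\<close>

lemma multiplicity_fact_mult:
  assumes "prime p"
  shows "b \<le> multiplicity p (fact (p * b) :: nat)"
    and "p \<le> b \<Longrightarrow> b < multiplicity p (fact (p * b) :: nat)"
proof -
  have p2: "2 \<le> p" using assms by (rule prime_ge_2_nat)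
  have *: "(p - 1) * multiplicity p (fact (p * b) :: nat) + digit_sum p b = (p - 1) * b + b"
    using legendre_digit_sum[OF assms, of "p * b"] digit_sum_mult_base[OF p2, of b] p2
    by (cases p) auto
  have "(p - 1) * b \<le> (p - 1) * multiplicity p (fact (p * b) :: nat)"
    using * digit_sum_le[OF assms, of b] by linarith
  thus "b \<le> multiplicity p (fact (p * b) :: nat)" using p2 by simp
  assume "p \<le> b"
  hence "(p - 1) * b < (p - 1) * multiplicity p (fact (p * b) :: nat)"
    using * digit_sum_less_self[OF assms, of b] by linarith
  thus "b < multiplicity p (fact (p * b) :: nat)" by simp
qed

text \<open>This is \<open>fact n / (fact k * fact l)\<close> times
  \<open>((n + s) choose s) / p ^ s\<close> with \<open>fact n\<close> cancelled. At
  \<open>l = c\<close>, where \<open>n = k + (p - 1) * s + c\<close>, its valuation depends on digit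
  sums only.\<close>

definition term_weight :: "nat \<Rightarrow> nat \<Rightarrow> nat \<Rightarrow> nat \<Rightarrow> nat \<Rightarrow> rat" where
  "term_weight p n k s l = fact (n + s) / (fact k * fact l * fact s * of_nat p ^ s)"

lemma shifted_coeff_expansion:
  assumes "prime p" "k + l \<le> n"
  shows "of_nat (shifted_coeff n k l) =
    (\<Sum>s=0..n - k - l. if (p - 1) * s \<le> n - k - l
      then (-1) ^ (p * s) * (term_weight p n k s l * expansion_cofactor p n s (n - k - l - (p - 1) * s))
      else 0)"
proof -
  have "of_nat (shifted_coeff n k l) =
      fact n / (fact k * fact l) * fps_nth (inverse log_quot ^ Suc n) (n - k - l)"
    unfolding shifted_coeff_def of_nat_mult Stirling_eq_log_quot_coeff[OF assms(2)]
    by (simp add: binomial_fact mult_ac del: power_Suc)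
  also have "\<dots> = (\<Sum>s=0..n - k - l. if (p - 1) * s \<le> n - k - l
      then (-1) ^ (p * s) * (term_weight p n k s l * expansion_cofactor p n s (n - k - l - (p - 1) * s))
      else 0)"
    unfolding log_quot_inverse_power_expansion[OF assms(1)] sum_distrib_left
    by (intro sum.cong refl) (simp add: term_weight_def binomial_fact mult_ac)
  finally show ?thesis .
qed

context bottom_digits
begin

text \<open>The least valuation of the coefficients of \<open>F n k\<close>. The division is exact,
  by \<open>digit_sum_cong\<close> for \<open>B\<close> and \<open>k\<close>.\<close>

definition shift :: int where
  "shift = (int (digit_sum p k) - int (digit_sum p B)) div int (p - 1)"

lemma shift: "int (p - 1) * shift = int (digit_sum p k) - int (digit_sum p B)"
proof -
  have "int (digit_sum p k) - int (digit_sum p B) =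
      (int B - int (digit_sum p B)) - (int k - int (digit_sum p k)) - int (p - 1) * int r"
    using arg_cong[OF B_k, of int] by (simp only: of_nat_add of_nat_mult)
  hence "int (p - 1) dvd int (digit_sum p k) - int (digit_sum p B)"
    using digit_sum_cong[OF p, of B] digit_sum_cong[OF p, of k]
    by (simp only: dvd_diff dvd_triv_left)
  thus ?thesis by (simp add: shift_def)
qed

lemma term_weight_nonzero: "term_weight p n k s l \<noteq> 0"
  using p2 by (simp add: term_weight_def)

text \<open>Legendre's formula for the four factorials; the linear parts cancel because
  \<open>n + s = k + c + s + (p - 1) * s\<close>.\<close>

lemma padic_val_term_weight:
  assumes "n = k + (p - 1) * s + c"
  shows "int (p - 1) * (padic_val p (term_weight p n k s c) - shift) =
    int (digit_sum p B + digit_sum p s + digit_sum p c) - int (digit_sum p (n + s))"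
proof -
  have fact: "padic_val p (fact x) = int (multiplicity p (fact x :: nat))" for x
    using padic_val_of_nat[OF p, of "fact x"] by simp
  have leg: "int (p - 1) * padic_val p (fact x) = int x - int (digit_sum p x)" for x
    unfolding fact using arg_cong[OF legendre_digit_sum[OF p, of x], of int]
    by (simp only: of_nat_add of_nat_mult)
  have pw: "padic_val p (of_nat p ^ s) = int s"
    using padic_val_of_nat[OF p, of "p ^ s"] p2 p by simp
  have "padic_val p (term_weight p n k s c) = padic_val p (fact (n + s)) -
      (padic_val p (fact k) + padic_val p (fact c) + padic_val p (fact s) + int s)"
    unfolding term_weight_def using p2 by (simp add: padic_val_divide[OF p] padic_val_mult[OF p] pw)
  hence "int (p - 1) * padic_val p (term_weight p n k s c) =
      (int (n + s) - int (digit_sum p (n + s))) - (int k - int (digit_sum p k)) -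
      (int c - int (digit_sum p c)) - (int s - int (digit_sum p s)) - int (p - 1) * int s"
    by (simp only: leg[symmetric]) (simp only: algebra_simps)
  thus ?thesis
    using shift arg_cong[OF assms, of int] by (simp add: right_diff_distrib)
qed

lemma padic_ge_term_weight:
  assumes "n = k + (p - 1) * s + c"
  shows "padic_ge p shift (term_weight p n k s c)"
    and "digit_sum p (n + s) < digit_sum p B + digit_sum p s + digit_sum p c \<Longrightarrow>
      padic_ge p (shift + 1) (term_weight p n k s c)"
proof -
  have "0 \<le> int (p - 1) * (padic_val p (term_weight p n k s c) - shift)"
    unfolding padic_val_term_weight[OF assms] using slack_nonneg[OF assms] by simp
  thus "padic_ge p shift (term_weight p n k s c)"
    using p2 by (simp add: padic_ge_def zero_le_mult_iff)
  assume "digit_sum p (n + s) < digit_sum p B + digit_sum p s + digit_sum p c"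
  hence "0 < int (p - 1) * (padic_val p (term_weight p n k s c) - shift)"
    unfolding padic_val_term_weight[OF assms] by simp
  thus "padic_ge p (shift + 1) (term_weight p n k s c)"
    using p2 by (simp add: padic_ge_def zero_less_mult_iff)
qed

lemma padic_val_term_weight_eq:
  assumes "n = k + (p - 1) * s + c"
    and "digit_sum p (n + s) = digit_sum p B + digit_sum p s + digit_sum p c"
  shows "padic_val p (term_weight p n k s c) = shift"
  using padic_val_term_weight[OF assms(1)] assms(2) p2 by simp

text \<open>Passing from \<open>c\<close> to \<open>l\<close> gains the factor
  \<open>fact c / fact l\<close>, a multiple of \<open>fact (c - l)\<close>. It supplies
  \<open>p ^ b\<close> whenever \<open>p * b \<le> c - l\<close>, enough to pay for the denominators
  in the cofactor.\<close>

lemma padic_ge_term: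
  assumes "padic_ge p E (term_weight p n k s c)" "l \<le> c"
  shows "padic_ge p E (term_weight p n k s l * expansion_cofactor p n s (c - l))"
proof (intro padic_ge_expansion_cofactor[OF p])
  fix b assume b: "p * b \<le> c - l"
  have "fact c = (fact l * (fact (c - l) * of_nat (c choose l)) :: rat)"
    using assms(2) by (simp add: binomial_fact)
  hence w: "term_weight p n k s l = term_weight p n k s c * of_nat (fact (c - l) * (c choose l))"
    using assms(2) by (simp add: term_weight_def)
  have "b \<le> multiplicity p (fact (c - l) :: nat)"
    using multiplicity_fact_mult(1)[OF p] multiplicity_fact_mono[OF p b] order_trans by blast
  also have "\<dots> \<le> multiplicity p (fact (c - l) * (c choose l))"
    using p assms(2) by (intro dvd_imp_multiplicity_le) auto
  finally have "padic_ge p (int b) (of_nat (fact (c - l) * (c choose l)))"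
    by (rule padic_ge_of_nat_multiplicity[OF p])
  from padic_ge_mult[OF p padic_ge_mult[OF p assms(1) this] padic_ge_log_pole_part_power[OF p, of b s]]
  show "padic_ge p E (term_weight p n k s l * fps_nth (log_pole_part p ^ s) b)"
    unfolding w[symmetric] by (rule padic_ge_mono) simp
qed

lemma n_split:
  assumes "k + l \<le> n" "(p - 1) * s \<le> n - k - l"
  obtains c where "n = k + (p - 1) * s + c" "l \<le> c" "n - k - l - (p - 1) * s = c - l"
  using assms by (intro that[of "n - k - (p - 1) * s"]) auto

lemma padic_ge_shifted_coeff: "padic_ge p shift (of_nat (shifted_coeff n k l))"
proof (cases "k + l \<le> n")
  case True
  show ?thesis
    unfolding shifted_coeff_expansion[OF p True]
  proof (intro padic_ge_sum[OF p])
    fix s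
    show "padic_ge p shift (if (p - 1) * s \<le> n - k - l
      then (-1) ^ (p * s) * (term_weight p n k s l * expansion_cofactor p n s (n - k - l - (p - 1) * s))
      else 0)"
    proof (cases "(p - 1) * s \<le> n - k - l")
      case s: True
      obtain c where c: "n = k + (p - 1) * s + c" "l \<le> c" "n - k - l - (p - 1) * s = c - l"
        using n_split[OF True s] by metis
      show ?thesis
        using s padic_ge_term[OF padic_ge_term_weight(1)[OF c(1)] c(2)]
        unfolding c(3) by (simp add: padic_ge_sign[OF p])
    qed simp
  qed
qed (simp add: shifted_coeff_def)

lemma padic_ge_shifted_coeff_less_r:
  assumes "k + l \<le> n" "(p - 1) * s \<le> n - k - l" "s < r"
  shows "padic_ge p (shift + 1)
    (term_weight p n k s l * expansion_cofactor p n s (n - k - l - (p - 1) * s))"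
proof -
  obtain c where c: "n = k + (p - 1) * s + c" "l \<le> c" "n - k - l - (p - 1) * s = c - l"
    using n_split[OF assms(1,2)] by metis
  show ?thesis
    using padic_ge_term[OF padic_ge_term_weight(2)[OF c(1) slack_pos_less[OF c(1) assms(3)]] c(2)]
    unfolding c(3) .
qed

text \<open>Beyond \<open>l = n - B\<close> the degree left is below \<open>(p - 1) * r\<close>, so
  only indices \<open>s < r\<close> occur, and their excess is positive.\<close>

lemma padic_ge_shifted_coeff_high:
  assumes "n - B < l"
  shows "padic_ge p (shift + 1) (of_nat (shifted_coeff n k l))"
proof (cases "k + l \<le> n")
  case True
  have "n - k - l < (p - 1) * r"
    using assms True B_k n_eq by linarith
  hence "(p - 1) * s < (p - 1) * r" if "(p - 1) * s \<le> n - k - l" for s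
    using that by linarith
  hence "s < r" if "(p - 1) * s \<le> n - k - l" for s
    using that by (simp only: mult_less_cancel1)
  thus ?thesis
    unfolding shifted_coeff_expansion[OF p True]
    using padic_ge_shifted_coeff_less_r[OF True]
    by (intro padic_ge_sum[OF p]) (auto simp: padic_ge_sign[OF p])
qed (simp add: shifted_coeff_def)

text \<open>Exactly one dominant term: at \<open>s = r\<close> the cofactor is 1 and the excess is
  zero by \<open>slack_r\<close>, while all other indices satisfy \<open>s < r\<close>.\<close>

lemma padic_val_shifted_coeff:
  "shifted_coeff n k (n - B) \<noteq> 0 \<and> padic_val p (of_nat (shifted_coeff n k (n - B))) = shift"
proof -
  define l where "l = n - B"
  have l: "k + l \<le> n" "n - k - l = (p - 1) * r" using B_k n_eq by (auto simp: l_def)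
  define f where "f = (\<lambda>s. if (p - 1) * s \<le> n - k - l
      then (-1) ^ (p * s) * (term_weight p n k s l * expansion_cofactor p n s (n - k - l - (p - 1) * s))
      else 0)"
  \<comment> \<open>Places \<open>r\<close> in the range of summation.\<close>
  have "r \<le> (p - 1) * r" using p2 by (cases "p - 1") auto
  hence "of_nat (shifted_coeff n k l) = f r + (\<Sum>s\<in>{0..n - k - l} - {r}. f s)"
    unfolding shifted_coeff_expansion[OF p l(1)] f_def[symmetric]
    using l(2) by (intro sum.remove) auto
  moreover have "padic_ge p (shift + 1) (\<Sum>s\<in>{0..n - k - l} - {r}. f s)"
  proof (intro padic_ge_sum[OF p])
    fix s assume s: "s \<in> {0..n - k - l} - {r}"
    show "padic_ge p (shift + 1) (f s)"
    proof (cases "(p - 1) * s \<le> n - k - l")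
      case True
      hence "s < r" using s l(2) p2 by simp
      thus ?thesis
        using padic_ge_shifted_coeff_less_r[OF l(1) True] True by (simp add: f_def padic_ge_sign[OF p])
    qed (simp add: f_def)
  qed
  moreover have "f r \<noteq> 0" "padic_val p (f r) = shift"
  proof -
    have f: "f r = (-1) ^ (p * r) * term_weight p n k r l"
      unfolding f_def l(2) by (simp add: expansion_cofactor_0[OF p])
    show "f r \<noteq> 0" unfolding f using term_weight_nonzero by simp
    have "n = k + (p - 1) * r + l" using l by linarith
    from padic_val_term_weight_eq[OF this]
    have "padic_val p (term_weight p n k r l) = shift" using slack_r by (simp add: l_def)
    moreover have "padic_val p ((-1) ^ (p * r)) = 0"
      using padic_val_divide_int[OF p, of "(-1) ^ (p * r)" 1] p
      by (cases "even (p * r)") (auto simp: multiplicity_unit_right)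
    ultimately show "padic_val p (f r) = shift"
      unfolding f using padic_val_mult[OF p, of "(-1) ^ (p * r)"] term_weight_nonzero by simp
  qed
  ultimately show ?thesis
    using padic_val_add_higher[OF p] unfolding l_def[symmetric] by (metis of_nat_0)
qed

lemma of_nat_binomial_Stirling_eq_sum:
  "(of_nat ((n choose d) * Stirling (n - d) k) :: rat) =
    (\<Sum>l\<le>n. (-1) ^ (l + d) * (of_nat (stirling (Suc l) (Suc d)) * of_nat (shifted_coeff n k l)))"
  using arg_cong[OF binomial_Stirling_eq_sum_shifted_coeff[of n d k], of "of_int :: int \<Rightarrow> rat"]
  by (simp add: mult.assoc del: Stirling.simps stirling.simps)

lemma padic_ge_coeff: "padic_ge p shift (of_nat ((n choose d) * Stirling (n - d) k))"
  unfolding of_nat_binomial_Stirling_eq_sum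
  using padic_ge_mult[OF p padic_ge_of_nat[OF p] padic_ge_shifted_coeff]
  by (intro padic_ge_sum[OF p]) (simp add: padic_ge_sign[OF p] del: stirling.simps)

text \<open>The change of basis is triangular: only \<open>l \<ge> d\<close> contribute.\<close>

lemma padic_ge_coeff_high:
  assumes "n - B < d"
  shows "padic_ge p (shift + 1) (of_nat ((n choose d) * Stirling (n - d) k))"
  unfolding of_nat_binomial_Stirling_eq_sum
proof (intro padic_ge_sum[OF p])
  fix l
  show "padic_ge p (shift + 1)
    ((-1) ^ (l + d) * (of_nat (stirling (Suc l) (Suc d)) * of_nat (shifted_coeff n k l)))"
  proof (cases "l < d")
    case False
    hence "n - B < l" using assms by simp
    from padic_ge_mult[OF p padic_ge_of_nat[OF p] padic_ge_shifted_coeff_high[OF this]]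
    show ?thesis by (simp add: padic_ge_sign[OF p] del: stirling.simps)
  qed (simp del: stirling.simps)
qed

text \<open>The diagonal entry of the change of basis is 1, so \<open>l = n - B\<close>
  dominates.\<close>

lemma padic_val_coeff:
  "(n choose (n - B)) * Stirling B k \<noteq> 0 \<and>
    padic_val p (of_nat ((n choose (n - B)) * Stirling B k)) = shift"
proof -
  define d where "d = n - B"
  have d: "n - d = B" "d \<le> n" using n_eq by (auto simp: d_def)
  define f :: "nat \<Rightarrow> rat" where "f = (\<lambda>l. (-1) ^ (l + d) *
    (of_nat (stirling (Suc l) (Suc d)) * of_nat (shifted_coeff n k l)))"
  have "of_nat ((n choose d) * Stirling (n - d) k) = f d + (\<Sum>l\<in>{..n} - {d}. f l)"
    unfolding of_nat_binomial_Stirling_eq_sum f_def[symmetric] using d by (intro sum.remove) auto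
  moreover have "padic_ge p (shift + 1) (\<Sum>l\<in>{..n} - {d}. f l)"
  proof (intro padic_ge_sum[OF p])
    fix l assume l: "l \<in> {..n} - {d}"
    show "padic_ge p (shift + 1) (f l)"
    proof (cases "l < d")
      case False
      hence "n - B < l" using l by (simp add: d_def)
      from padic_ge_mult[OF p padic_ge_of_nat[OF p] padic_ge_shifted_coeff_high[OF this]]
      show ?thesis by (simp add: f_def padic_ge_sign[OF p] del: stirling.simps)
    qed (simp add: f_def del: stirling.simps)
  qed
  moreover have "f d = of_nat (shifted_coeff n k (n - B))"
    by (simp add: f_def d_def del: stirling.simps flip: mult_2)
  hence "f d \<noteq> 0" "padic_val p (f d) = shift"
    using padic_val_shifted_coeff by auto
  ultimately show ?thesis
    using padic_val_add_higher[OF p] d unfolding d_def[symmetric] by (metis of_nat_0)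
qed

lemma shift_nonneg: "0 \<le> shift"
  using padic_val_coeff padic_val_of_nat[OF p, of "(n choose (n - B)) * Stirling B k"] by simp

end

section \<open>The constant term\<close>

context bottom_digits
begin

text \<open>At \<open>l = 0\<close> the whole of \<open>fact c\<close> is available against a loss
  of at most \<open>b div (p - 1)\<close>. It gives the extra factor \<open>p\<close> unless
  \<open>c = p - 1\<close>, or \<open>p = 2\<close>, \<open>b = 1\<close> and \<open>c\<close> is 2
  or 3; there it comes from strict digit inequalities or from the parity of
  \<open>s\<close>.\<close>

lemma padic_ge_constant_term_summand:
  assumes s: "n = k + (p - 1) * s + c" and c: "c = (p - 1) * \<delta>" and "0 < \<delta>"
    and k: "p = 2 \<Longrightarrow> k \<noteq> 1" and b: "p * b \<le> c"
  shows "padic_ge p (shift + 1) (term_weight p n k s 0 * fps_nth (log_pole_part p ^ s) b)"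
proof -
  define v where "v = multiplicity p (fact c :: nat)"
  have w: "term_weight p n k s 0 = term_weight p n k s c * of_nat (fact c)"
    by (simp add: term_weight_def)
  have v: "padic_ge p (int v) (of_nat (fact c))"
    unfolding v_def by (rule padic_ge_of_nat_multiplicity[OF p]) simp
  have combine: "padic_ge p (shift + 1) (term_weight p n k s 0 * fps_nth (log_pole_part p ^ s) b)"
    if "padic_ge p x (term_weight p n k s c)" "padic_ge p y (fps_nth (log_pole_part p ^ s) b)"
      "shift + 1 \<le> x + int v + y" for x y
    unfolding w by (rule padic_ge_mono[OF padic_ge_mult[OF p padic_ge_mult[OF p that(1) v] that(2)] that(3)])
  note weight = padic_ge_term_weight(1)[OF s]
  note pole = padic_ge_log_pole_part_power[OF p, of b s]
  have generic: "padic_ge p (shift + 1) (term_weight p n k s 0 * fps_nth (log_pole_part p ^ s) b)"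
    if "b div (p - 1) < v"
    by (rule combine[OF weight pole]) (use that in simp)
  have bv: "b \<le> v"
    unfolding v_def using multiplicity_fact_mult(1)[OF p] multiplicity_fact_mono[OF p b] order_trans by blast
  show ?thesis
  proof (cases "\<delta> = 1")
    case True
    hence "c = p - 1" using c by simp
    hence "p * b < p * 1" using b p2 by linarith
    hence "b = 0" by (simp only: mult_less_cancel1) simp
    show ?thesis
    proof (rule combine[OF _ pole])
      show "padic_ge p (shift + 1) (term_weight p n k s c)"
        using padic_ge_term_weight(2)[OF s slack_pos_last[OF s]] c True by simp
    qed (simp add: \<open>b = 0\<close>)
  next
    case False
    hence \<delta>: "2 \<le> \<delta>" using \<open>0 < \<delta>\<close> by simp
    have "(p - 1) * 2 \<le> c" unfolding c using \<delta> by (intro mult_le_mono2)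
    hence "p \<le> c" using p2 by linarith
    hence v1: "1 \<le> v"
      using p prime_multiplicity_gt_zero_iff[of p "fact c"] unfolding v_def
      by (simp add: prime_dvd_fact_iff Suc_le_eq)
    show ?thesis
    proof (cases "p = 2")
      case False
      hence "2 \<le> p - 1" using p2 by simp
      hence "b div (p - 1) \<le> b div 2" by (intro div_le_mono2) auto
      moreover have "b div 2 < b \<or> b = 0" by auto
      ultimately show ?thesis using generic bv v1 by force
    next
      case p_2: True
      have c\<delta>: "c = \<delta>" using c p_2 by simp
      consider "b = 0" | "2 \<le> b" | "b = 1" "4 \<le> c" | "b = 1" "c = 2 \<or> c = 3"
        using \<delta> c\<delta> by linarith
      thus ?thesis
      proof cases
        case 1
        thus ?thesis using generic v1 by simp
      next
        case 2
        hence "b < multiplicity p (fact (p * b) :: nat)"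
          by (intro multiplicity_fact_mult(2)[OF p]) (simp add: p_2)
        hence "b < v"
          unfolding v_def using multiplicity_fact_mono[OF p b] by linarith
        thus ?thesis using generic p_2 by simp
      next
        case 3
        have "2 < multiplicity p (fact (p * 2) :: nat)"
          by (rule multiplicity_fact_mult(2)[OF p]) (simp add: p_2)
        hence "2 < v"
          unfolding v_def using multiplicity_fact_mono[OF p, of "p * 2" c] 3 p_2 by simp
        thus ?thesis using generic p_2 3 by simp
      next
        case 4
        show ?thesis
        \<comment> \<open>Here the gain and the bounded loss are both 1. For even \<open>s\<close>
          there is no loss, since the linear coefficient of \<open>log_pole_part p ^ s\<close> is
          \<open>s / 2\<close>; for odd \<open>s\<close> the digit excess is positive.\<close>
        proof (cases "even s")
          case True
          then obtain t where t: "s = 2 * t" by auto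
          have "fps_nth (log_pole_part p ^ s) 1 = of_nat s * fps_nth (log_pole_part p) 1"
            by (rule fps_power_first_eq) (simp add: log_pole_part_def)
          also have "\<dots> = of_nat t"
            by (simp add: log_pole_part_def p_2 t)
          finally have "padic_ge p 0 (fps_nth (log_pole_part p ^ s) b)"
            using padic_ge_of_nat[OF p] 4 by simp
          from combine[OF weight this] show ?thesis using v1 by simp
        next
          case False
          \<comment> \<open>Equality would make \<open>2 ^ j\<close> divide \<open>c\<close>, so
            \<open>j \<le> 1\<close>. Then \<open>B = 1\<close>, or \<open>B = 2\<close> with
            \<open>r = 1\<close>; both give the excluded \<open>k = 1\<close>.\<close>
          have "s mod p ^ j \<noteq> r"
          proof
            assume sr: "s mod p ^ j = r"
            have "s + c = r + 2 ^ j * q"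
              using s n_eq B_k p_2 by simp
            moreover have "s = r + 2 ^ j * (s div 2 ^ j)"
              using mod_mult_div_eq[of s "p ^ j"] sr unfolding p_2 by linarith
            ultimately have "2 ^ j * (s div 2 ^ j) + c = 2 ^ j * q" by linarith
            hence "2 ^ j dvd c" by (metis dvd_add_right_iff dvd_triv_left)
            show False
            proof (cases "j = 0")
              case True
              hence "B = 1" using B0_less m_pos m_less p_2 B_eq by simp
              thus False using B_k k p_2 True r_less by simp
            next
              case j: False
              have "even c" using \<open>2 ^ j dvd c\<close> j by (metis dvd_power dvd_trans gr0I)
              hence c2: "c = 2" using 4 by auto
              have "j = 1"
              proof (rule ccontr)
                assume "j \<noteq> 1"
                hence "2 ^ 2 dvd (2 ^ j :: nat)" using j by (intro le_imp_power_dvd) simp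
                hence "2 ^ 2 dvd c" using \<open>2 ^ j dvd c\<close> dvd_trans by blast
                thus False using c2 by simp
              qed
              hence "r = 1" using sr False p_2 by (simp add: odd_iff_mod_2_eq_one)
              hence "B0 = 0" "m = 1" using B0_r_less m_pos m_less \<open>j = 1\<close> p_2 by auto
              hence "B = 2" using B_eq \<open>j = 1\<close> p_2 by simp
              thus False using B_k k p_2 \<open>r = 1\<close> by simp
            qed
          qed
          from combine[OF padic_ge_term_weight(2)[OF s slack_pos_2[OF s p_2 this]] pole]
          show ?thesis using v1 4 p_2 by simp
        qed
      qed
    qed
  qed
qed

text \<open>In the expansion of \<open>F n k\<close> at \<open>x = 0\<close> the pair
  \<open>l = 0\<close>, \<open>s = S\<close> dominates: it has excess zero by
  \<open>slack_max\<close>, and all other pairs have \<open>s < S\<close>.\<close>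

lemma padic_val_Stirling:
  assumes "p - 1 dvd n - k" "0 < k"
  shows "padic_val p (of_nat (Stirling n k)) = shift"
\<comment> \<open>The case excluded from the summand estimate is immediate:
  \<open>Stirling n 1 = 1\<close>, and \<open>shift\<close> is squeezed to 0.\<close>
proof (cases "p = 2 \<and> k = 1")
  case True
  have "0 < n" using assms B_k n_eq by simp
  hence "Stirling n k = 1" using True by (cases n) (auto simp del: Stirling.simps)
  moreover have "shift \<le> 0"
  proof -
    have "0 < digit_sum p B" using digit_sum_pos[OF p2, of B] B_k assms by simp
    moreover have "digit_sum p k \<le> 1" using digit_sum_le[OF p, of k] True by simp
    moreover have "int (p - 1) = 1" using True by simp
    ultimately show ?thesis using shift by simp
  qed
  ultimately show ?thesis using shift_nonneg padic_val_of_nat[OF p, of 1] by simp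
next
  case False
  obtain S where S: "n - k = (p - 1) * S" using assms by auto
  have kn: "k \<le> n" using B_k n_eq by simp
  \<comment> \<open>Multiplication by \<open>fact l\<close> has turned the weight at
    \<open>l\<close> into the weight at 0, so \<open>l\<close> enters only through the
    cofactor.\<close>
  define f where "f = (\<lambda>l s. (-1) ^ (p * s) *
    (term_weight p n k s 0 * expansion_cofactor p n s (n - k - l - (p - 1) * s)))"
  have f_ge: "padic_ge p (shift + 1) (f l s)" if "k + l \<le> n" "(p - 1) * s \<le> n - k - l" "s < S" for l s
  proof -
    note split = n_split[OF that(1,2)]
    obtain c where c: "n = k + (p - 1) * s + c" "l \<le> c" "n - k - l - (p - 1) * s = c - l"
      using split by metis
    have "(p - 1) * S = (p - 1) * s + (p - 1) * (S - s)"
      using that(3) by (simp flip: distrib_left)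
    hence c': "c = (p - 1) * (S - s)" using S c(1) by linarith
    show ?thesis
      unfolding f_def c(3) padic_ge_sign[OF p]
      using padic_ge_constant_term_summand[OF c(1) c'] that(3) False
      by (intro padic_ge_expansion_cofactor[OF p]) auto
  qed
  have y: "fact l * of_nat (shifted_coeff n k l) =
      (\<Sum>s=0..n - k - l. if (p - 1) * s \<le> n - k - l then f l s else 0)" if "k + l \<le> n" for l
    unfolding shifted_coeff_expansion[OF p that] sum_distrib_left
    by (intro sum.cong refl) (simp add: f_def term_weight_def)
  have g_ge: "padic_ge p (shift + 1) (fact l * of_nat (shifted_coeff n k l))" if "0 < l" for l
  proof (cases "k + l \<le> n")
    case True
    have "s < S" if "(p - 1) * s \<le> n - k - l" for s
    proof -
      have "n - k - l < (p - 1) * S" using True \<open>0 < l\<close> S by simp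
      hence "(p - 1) * s < (p - 1) * S" using that by linarith
      thus ?thesis by (simp only: mult_less_cancel1)
    qed
    thus ?thesis
      unfolding y[OF True] using f_ge[OF True] by (intro padic_ge_sum[OF p]) simp
  qed (simp add: shifted_coeff_def)
  define f' where "f' = (\<lambda>s. if (p - 1) * s \<le> n - k then f 0 s else 0)"
  have S_le: "S \<le> n - k" unfolding S using p2 by (cases "p - 1") auto
  define rest where "rest = (\<Sum>s\<in>{0..n - k} - {S}. f' s) +
    (\<Sum>l\<in>{..n} - {0}. (-1) ^ l * (fact l * of_nat (shifted_coeff n k l)))"
  have "of_nat (shifted_coeff n k 0) = (\<Sum>s=0..n - k. f' s)"
    using y[of 0] kn by (simp add: f'_def)
  also have "\<dots> = f' S + (\<Sum>s\<in>{0..n - k} - {S}. f' s)"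
    using S_le by (intro sum.remove) auto
  finally have y0: "of_nat (shifted_coeff n k 0) = f' S + (\<Sum>s\<in>{0..n - k} - {S}. f' s)" .
  have "of_nat (Stirling n k) = (\<Sum>l\<le>n. (-1) ^ l * (fact l * of_nat (shifted_coeff n k l)) :: rat)"
    using of_nat_binomial_Stirling_eq_sum[of 0] by (simp add: stirling_Suc_n_1 del: stirling.simps)
  also have "\<dots> = of_nat (shifted_coeff n k 0) +
      (\<Sum>l\<in>{..n} - {0}. (-1) ^ l * (fact l * of_nat (shifted_coeff n k l)))"
    by (subst sum.remove[of _ 0]) auto
  finally have St: "of_nat (Stirling n k) = f' S + rest"
    unfolding y0 rest_def by simp
  have "padic_ge p (shift + 1) (f' s)" if "s \<in> {0..n - k} - {S}" for s
  proof (cases "(p - 1) * s \<le> n - k")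
    case True
    hence "s < S" using that S p2 by simp
    thus ?thesis using f_ge[of 0 s] True kn by (simp add: f'_def)
  qed (simp add: f'_def)
  hence rest: "padic_ge p (shift + 1) rest"
    unfolding rest_def using g_ge
    by (intro padic_ge_add padic_ge_sum p) (simp_all add: padic_ge_sign[OF p])
  have f'S: "f' S = (-1) ^ (p * S) * term_weight p n k S 0"
    unfolding f'_def f_def S by (simp add: expansion_cofactor_0[OF p])
  have "n = k + (p - 1) * S + 0" using S kn by linarith
  from padic_val_term_weight_eq[OF this]
  have w: "padic_val p (term_weight p n k S 0) = shift" using slack_max[OF S kn] by simp
  have "padic_ge p shift (f' S)" "\<not> padic_ge p (shift + 1) (f' S)"
    unfolding f'S padic_ge_sign[OF p] using w term_weight_nonzero by (auto simp: padic_ge_def)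
  hence "f' S \<noteq> 0" "padic_val p (f' S) = shift" by (auto dest: padic_val_unique)
  thus ?thesis
    unfolding St using padic_val_add_higher[OF p _ _ rest] by blast
qed

section \<open>Maximum pole of the Bernoulli polynomial and its first occurrence\<close>

lemma max_pole_bernoulli_poly:
  defines "f \<equiv> bernoulli_poly (n - k) (- int k)"
    and "M \<equiv> int (multiplicity p (n choose k)) - shift"
  shows "max_pole p f = M" and "first_pole_occurrence p f M (n - B)"
proof -
  have kn: "k \<le> n" and Bn: "n - (n - B) = B" using B_k n_eq by auto
  have nz: "n choose k \<noteq> 0" using kn by simp
  note coeff = coeff_bernoulli_poly[OF kn, folded f_def]
  have val: "padic_val p (coeff f d) =
      padic_val p (of_nat ((n choose d) * Stirling (n - d) k)) - int (multiplicity p (n choose k))"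
    if "coeff f d \<noteq> 0" for d
    using that nz unfolding coeff
    by (subst padic_val_divide[OF p]) (auto simp: padic_val_of_nat[OF p] simp del: Stirling.simps)
  have le: "M' \<le> M" if "has_pole p (coeff f d) M'" for d M'
    using that padic_ge_coeff[of d] val[of d] unfolding has_pole_def padic_ge_def coeff M_def by auto
  have less: "M' < M" if "has_pole p (coeff f d) M'" "n - B < d" for d M'
    using that padic_ge_coeff_high[of d] val[of d] unfolding has_pole_def padic_ge_def coeff M_def by auto
  have "coeff f (n - B) \<noteq> 0"
    using padic_val_coeff nz unfolding coeff Bn by auto
  hence eq: "has_pole p (coeff f (n - B)) M"
    using val[of "n - B"] padic_val_coeff by (simp add: has_pole_def M_def Bn)
  \<comment> \<open>Poles come from nonzero coefficients only, which makes the set in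
    \<open>max_pole\<close> finite.\<close>
  have "{M. \<exists>i. has_pole p (coeff f i) M} \<subseteq> (\<lambda>i. - padic_val p (coeff f i)) ` {..degree f}"
    by (auto simp: has_pole_def intro!: image_eqI le_degree)
  hence "finite {M. \<exists>i. has_pole p (coeff f i) M}"
    by (rule finite_subset) simp
  thus "max_pole p f = M"
    unfolding max_pole_def using le eq by (intro Max_eqI) auto
  show "first_pole_occurrence p f M (n - B)"
    unfolding first_pole_occurrence_def using eq less by blast
qed

text \<open>Kummer's theorem for \<open>n choose k\<close>; the digit sum of \<open>q\<close> occurs
  in both \<open>n\<close> and \<open>n - k\<close> and cancels.\<close>

lemma digit_sum_B_minus_k:
  "int (p - 1) * (int (multiplicity p (n choose k)) - shift) = int (digit_sum p (B - k))"
proof -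
  have "k + (n - k) = n" using B_k n_eq by simp
  hence "(p - 1) * multiplicity p (n choose k) + digit_sum p n = digit_sum p k + digit_sum p (n - k)"
    using digit_sum_binomial[OF p, of k "n - k"] by simp
  hence "int (p - 1) * int (multiplicity p (n choose k)) =
      int (digit_sum p k) + int (digit_sum p (n - k)) - int (digit_sum p n)"
    by (metis add_diff_cancel_right' of_nat_add of_nat_mult)
  thus ?thesis
    using shift digit_sum_n_minus_k digit_sum_n by (simp add: right_diff_distrib)
qed

end

section \<open>Digit data of a bottom segment\<close>

lemma sum_base_digit: "(\<Sum>i<j. base_digit p n i * p ^ i) = n mod p ^ j"
proof (induction j)
  case (Suc j)
  have "n mod p ^ Suc j = p ^ j * (n div p ^ j mod p) + n mod p ^ j"
    unfolding power_Suc2 by (rule mod_mult2_eq)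
  thus ?case using Suc by (simp add: base_digit_def mult.commute)
qed simp

text \<open>Dropping leading zeros lets a bottom segment with \<open>m = 0\<close> be rewritten with
  a nonzero top digit.\<close>

lemma mod_power_top_digit:
  assumes "0 < n mod p ^ j"
  shows "\<exists>j' m. 0 < m \<and> m \<le> base_digit p n j' \<and> n mod p ^ j = n mod p ^ j' + m * p ^ j'"
  using assms
proof (induction j)
  case (Suc j)
  have eq: "n mod p ^ Suc j = n mod p ^ j + base_digit p n j * p ^ j"
    using sum_base_digit[of p n "Suc j"] sum_base_digit[of p n j] by simp
  show ?case
  proof (cases "base_digit p n j = 0")
    case True
    thus ?thesis using Suc unfolding eq by simp
  next
    case False
    thus ?thesis unfolding eq by (intro exI[of _ j] exI[of _ "base_digit p n j"]) simp
  qed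
qed simp

lemma bottom_digits_exists:
  assumes p: "prime p" and B: "bottom_segment p n B" and k: "0 < k" "k \<le> B"
    and dvd: "p - 1 dvd B - k"
    and ndvd: "\<not> p dvd ((n + (B - k) div (p - 1)) choose n)"
  obtains j m q B0 where "bottom_digits p j m q B0 ((B - k) div (p - 1)) k n B"
proof -
  have p2: "2 \<le> p" using p by (rule prime_ge_2_nat)
  define r where "r = (B - k) div (p - 1)"
  have Bk: "B = k + (p - 1) * r" using dvd k by (simp add: r_def)
  obtain j m where m: "0 < m" "m \<le> base_digit p n j" "B = n mod p ^ j + m * p ^ j"
  proof -
    obtain j m where jm: "m \<le> base_digit p n j" "B = n mod p ^ j + m * p ^ j"
      using B unfolding bottom_segment_def sum_base_digit by blast
    show ?thesis
    proof (cases "m = 0")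
      case True
      hence "0 < n mod p ^ j" "B = n mod p ^ j" using jm k by auto
      thus ?thesis using that mod_power_top_digit by blast
    qed (use that jm in blast)
  qed
  define B0 Q q where "B0 = n mod p ^ j" "Q = n div p ^ j" "q = Q - m"
  note defs = this
  have B0: "B0 < p ^ j" using p2 by (simp add: defs)
  have n: "n = B0 + p ^ j * Q" by (simp add: defs)
  have mQ: "m \<le> Q mod p" using m(2) by (simp add: defs base_digit_def)
  have "q = (Q mod p - m) + p * (Q div p)"
    using mQ mod_mult_div_eq[of Q p] unfolding defs(3) by linarith
  hence "q mod p = (Q mod p - m) mod p" by simp
  also have "\<dots> = Q mod p - m" using p2 by (intro mod_less) (simp add: less_imp_diff_less)
  finally have qm: "m + q mod p = Q mod p" using mQ by simp
  have "m \<le> Q" using mQ mod_less_eq_dividend[of Q p] by linarith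
  hence Q: "Q = m + q" by (simp add: defs(3))
  have B_eq: "B = B0 + p ^ j * m"
    using m(3) by (simp add: defs(1) mult.commute)
  have nB: "n = B + p ^ j * q"
    unfolding n Q B_eq by (simp add: distrib_left)
  have nr: "digit_sum p (n + r) = digit_sum p n + digit_sum p r"
    using digit_sum_binomial[OF p, of n r] ndvd not_dvd_imp_multiplicity_0[of p "(n + r) choose n"]
    by (simp add: r_def)
  have dn: "digit_sum p n = digit_sum p B0 + digit_sum p Q"
    unfolding n by (rule digit_sum_add_power_mult[OF p2 B0])
  have "B < p ^ j * Suc m" unfolding B_eq using B0 by simp
  hence lt: "(p - 1) * r < p ^ j * Suc m" using Bk by linarith
  \<comment> \<open>Otherwise \<open>(p - 1) * r \<le> B\<close> forces \<open>m = p - 1\<close>, so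
    digit \<open>j\<close> of \<open>n\<close> is \<open>p - 1\<close> while \<open>r\<close> has
    digit 1 there, and \<open>n + r\<close> carries.\<close>
  have r: "r < p ^ j"
  proof (rule ccontr)
    assume "\<not> r < p ^ j"
    hence ge: "p ^ j \<le> r" by simp
    have "p ^ j * (p - 1) < p ^ j * Suc m"
      using mult_le_mono2[OF ge, of "p - 1"] lt by (simp only: mult.commute)
    hence "p - 1 < Suc m" by (simp only: mult_less_cancel1)
    moreover have "Q mod p < p" using p2 by simp
    ultimately have m1: "m = p - 1" "Q mod p = p - 1" using mQ by auto
    have "r < 2 * p ^ j"
    proof (rule ccontr)
      assume "\<not> r < 2 * p ^ j"
      hence "(p - 1) * (2 * p ^ j) \<le> (p - 1) * r" by (intro mult_le_mono2) simp
      hence "p ^ j * (2 * (p - 1)) < p ^ j * Suc m" using lt by (simp only: mult_ac)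
      hence "2 * (p - 1) < Suc m" by (simp only: mult_less_cancel1)
      thus False using m1 p2 by simp
    qed
    define r0 where "r0 = r - p ^ j"
    have r0: "r = r0 + p ^ j * 1" "r0 < p ^ j" using ge \<open>r < 2 * p ^ j\<close> by (auto simp: r0_def)
    have dr: "digit_sum p r = digit_sum p r0 + 1"
      using digit_sum_add_power_mult[OF p2 r0(2), of 1] digit_sum_less_base[OF p2, of 1] p2 r0(1) by simp
    have "Q + 1 = (p - 1 + 1) + p * (Q div p)"
      using mod_mult_div_eq[of Q p] m1(2) by linarith
    hence Q1: "Q + 1 = p * (Q div p + 1)" using p2 by simp
    have "digit_sum p (Q + 1) = digit_sum p (Q div p + 1)"
      unfolding Q1 by (rule digit_sum_mult_base[OF p2])
    also have "\<dots> \<le> digit_sum p (Q div p) + 1"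
      using digit_sum_add_le[OF p, of "Q div p" 1] digit_sum_less_base[OF p2, of 1] p2 by simp
    finally have dQ1: "digit_sum p (Q + 1) \<le> digit_sum p (Q div p) + 1" .
    have dQ: "digit_sum p Q = p - 1 + digit_sum p (Q div p)"
      using digit_sum_rec[OF p2, of Q] m1 by simp
    have "n + r = (B0 + r0) + p ^ j * (Q + 1)" using n r0(1) by simp
    hence "digit_sum p (n + r) \<le> digit_sum p (B0 + r0) + digit_sum p (Q + 1)"
      using digit_sum_add_le[OF p] digit_sum_power_mult[OF p2] by metis
    thus False
      using nr dn dr dQ dQ1 digit_sum_add_le[OF p, of B0 r0] p2 by linarith
  qed
  have nr': "n + r = (B0 + r) + p ^ j * Q" using n by simp
  have B0r: "B0 + r < p ^ j"
  proof (rule ccontr)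
    assume "\<not> B0 + r < p ^ j"
    hence "digit_sum p (B0 + r) < digit_sum p B0 + digit_sum p r"
      using B0 r by (intro digit_sum_add_carry[OF p]) auto
    moreover have "digit_sum p (n + r) \<le> digit_sum p (B0 + r) + digit_sum p Q"
      unfolding nr' using digit_sum_add_le[OF p] digit_sum_power_mult[OF p2] by metis
    ultimately show False using nr dn by linarith
  qed
  have dB0r: "digit_sum p (B0 + r) = digit_sum p B0 + digit_sum p r"
    using nr dn digit_sum_add_power_mult[OF p2 B0r, of Q] unfolding nr' by linarith
  have "m + q mod p < p" unfolding qm using p2 by simp
  from bottom_digits.intro[OF p B0 m(1) this r B_eq nB Bk B0r dB0r]
  have "bottom_digits p j m q B0 r k n B" .
  thus ?thesis using that unfolding r_def by blast
qed

lemma Stirling_pos: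
  assumes "0 < k" "k \<le> n"
  shows "0 < Stirling n k"
  using assms
proof (induction n arbitrary: k)
  case (Suc n)
  then obtain k' where "k = Suc k'" by (cases k) auto
  thus ?case using Suc by (cases "k' = n") auto
qed simp

theorem theorem3p19:
  fixes p n B k :: nat and M :: int
  assumes "prime p"
    and "0 < n"
    and "bottom_segment p n B"
    and "0 < k" and "k \<le> B"
    and "p - 1 dvd B - k"
    and "\<not> p dvd ((n + (B - k) div (p - 1)) choose n)"
    and "M = max_pole p (bernoulli_poly (n - k) (- int k))"
  shows "(of_int M :: rat) = of_nat (digit_sum p (B - k)) / of_nat (p - 1) \<and>
         n - k - (B - k) = n - B \<and>
         first_pole_occurrence p (bernoulli_poly (n - k) (- int k)) M (n - B) \<and>
         (p - 1 dvd n - k \<longrightarrow>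
            AMZC p n k \<and>
            (of_nat (multiplicity p (Stirling n k)) :: rat) =
              (of_nat (digit_sum p k) - of_nat (digit_sum p B)) / of_nat (p - 1))"
proof -
  obtain j m q B0 where "bottom_digits p j m q B0 ((B - k) div (p - 1)) k n B"
    using bottom_digits_exists[OF assms(1,3-7)] .
  then interpret bottom_digits p j m q B0 "(B - k) div (p - 1)" k n B .
  have p1: "(of_nat (p - 1) :: rat) \<noteq> 0" using p2 by simp
  have M: "M = int (multiplicity p (n choose k)) - shift"
    using assms(8) max_pole_bernoulli_poly(1) by simp
  have "of_nat (p - 1) * (of_int M :: rat) = of_nat (digit_sum p (B - k))"
    using arg_cong[OF digit_sum_B_minus_k, of "of_int :: int \<Rightarrow> rat"] unfolding M by (simp only: of_int_mult of_int_of_nat_eq)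
  hence a: "(of_int M :: rat) = of_nat (digit_sum p (B - k)) / of_nat (p - 1)"
    using p1 by (metis nonzero_mult_div_cancel_left)
  have b: "AMZC p n k \<and> (of_nat (multiplicity p (Stirling n k)) :: rat) =
      (of_nat (digit_sum p k) - of_nat (digit_sum p B)) / of_nat (p - 1)" if "p - 1 dvd n - k"
  proof -
    have "0 < Stirling n k" using B_k n_eq assms(4) by (intro Stirling_pos) auto
    hence S: "int (multiplicity p (Stirling n k)) = shift"
      using padic_val_Stirling[OF that assms(4)] padic_val_of_nat[OF p] by simp
    have "of_nat (p - 1) * (of_nat (multiplicity p (Stirling n k)) :: rat) =
        of_nat (digit_sum p k) - of_nat (digit_sum p B)"
      using arg_cong[OF shift[folded S], of "of_int :: int \<Rightarrow> rat"]
      by (simp only: of_int_mult of_int_diff of_int_of_nat_eq)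
    hence "(of_nat (multiplicity p (Stirling n k)) :: rat) =
        (of_nat (digit_sum p k) - of_nat (digit_sum p B)) / of_nat (p - 1)"
      using p1 by (metis nonzero_mult_div_cancel_left)
    \<comment> \<open>The multiplicity of the Stirling number is \<open>shift\<close>, which is by
      \<open>M\<close> the multiplicity of \<open>n choose k\<close> minus \<open>M\<close>.\<close>
    moreover have "AMZC p n k"
      unfolding AMZC_def using S M assms(8) by linarith
    ultimately show ?thesis by blast
  qed
  show ?thesis
    using a b max_pole_bernoulli_poly(2) assms(5) M by auto
qed

end
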